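(* Let $n\geq4$. All absolute invariants, with respect to the pseudogroup $\mathscr P$ of point transformations, of $n$ arbitrary differential elements of the second order $(v_1,w_1),(v_2,w_2),\dots,(v_n,w_n)$ may be expressed as functions of the following invariants ($2n-8$ in number when $n\ge5$): the $n-3$ cross-ratios $$r_4,r_5,\dots,r_n,$$ depending only upon the first derivatives (directions) $v_k$ of the elements, and, when there are six or more elements, $n-5$ invariants of a new type $$\Omega_6,\Omega_7,\dots,\Omega_n,$$ which involve the second derivatives $w_k$ (curvature). The new type appears only when there are six or more elements. This system of invariants is functionally complete. Furthermore, all rational invariants, i.e. all invariants which involve $v_1,w_1,\dots,v_n,w_n$ rationally, can be expressed as rational functions of the fundamental invariants $r_j$ $(4\le j\le n)$ and $\Omega_l$ $(6\le l\le n)$.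
   Context: The pseudogroup $\mathscr P$ of point transformations $X=\phi(x,u)$, $U=\psi(x,u)$ of $(\mathbb{C}^2,0)$ ($\phi,\psi$ holomorphic, Jacobian nonzero) acts on second-order elements $(v,w)=(u',u'')$ above a given point through the eight-parameter group of transformations $$V=\frac{av+b}{cv+d},\qquad W=\frac{\lambda+\mu v+\nu v^2+\xi v^3+(ad-bc)w}{(cv+d)^3},$$ with $a,b,c,d,\lambda,\mu,\nu,\xi\in\mathbb{C}$ arbitrary subject to $ad-bc\neq0$. It acts simultaneously (with the same parameters) on $n$ elements $(v_1,w_1),\dots,(v_n,w_n)\in(\mathbb{C}^2)^n$. An absolute invariant is a function of the $2n$ quantities $v_k,w_k$ unchanged by this joint action; equivalently, it is annihilated by the eight infinitesimal generators obtained by summing over the $n$ elements $\partial_v,\ \partial_w,\ v\partial_v,\ w\partial_w,\ v^2\partial_v+3vw\,\partial_w,\ v\partial_w,\ v^2\partial_w,\ v^3\partial_w$. The elements are in general position. The quantities are defined by $$\xi_i=\frac{v_i-v_1}{v_2-v_1},\quad \eta_i=\frac{w_i-w_1}{w_2-w_1},\quad s_i=\frac{\eta_i}{\xi_i^3}\quad(3\le i\le n),$$ $$r_j=\frac{\xi_3(\xi_j-1)}{\xi_j(\xi_3-1)},\quad \sigma_j=\frac{s_j-1}{s_3-1},\quad \tau_j=\frac{\sigma_j-r_j}{\sigma_4-r_4}\quad(4\le j\le n),$$ $$\Omega_l=\frac{(r_4^2-r_4)\tau_l-(r_l^2-r_l)}{(r_4^2-r_4)\tau_5-(r_5^2-r_5)}\quad(6\le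 l\le n).$$ Functionally complete means that every absolute invariant is a function of the listed ones. *)

theory Defs
  imports Complex_Main "HOL-Library.FuncSet"
begin

text \<open>
  A system of \<open>n\<close> second-order elements is a pair \<open>(v, w)\<close> of families indexed by \<open>{1..n}\<close>:
  \<open>v k\<close> is the first and \<open>w k\<close> the second derivative of the \<open>k\<close>-th element.  Families are
  extensional, so that a function of \<open>(v, w)\<close> is a function of exactly \<open>2 * n\<close> complex quantities.
\<close>

type_synonym elements = "(nat \<Rightarrow> complex) \<times> (nat \<Rightarrow> complex)"

definition element_systems :: "nat \<Rightarrow> elements set" where
  "element_systems n = ({1..n} \<rightarrow>\<^sub>E UNIV) \<times> ({1..n} \<rightarrow>\<^sub>E UNIV)"

text \<open>
  The pseudogroup of point transformations acts on the second-order elements above a given point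
  through an eight-parameter group; all \<open>n\<close> elements are moved with the same parameters.
  The transformation is defined at \<open>(v, w)\<close> only if \<open>c * v k + d \<noteq> 0\<close> for all \<open>k\<close>
  (no direction is sent to infinity).  The parameter called \<open>\<lambda>\<close> in the literature is written \<open>\<kappa>\<close>.
\<close>

definition element_action ::
  "nat \<Rightarrow> complex \<Rightarrow> complex \<Rightarrow> complex \<Rightarrow> complex \<Rightarrow> complex \<Rightarrow> complex \<Rightarrow> complex \<Rightarrow> complex
    \<Rightarrow> elements \<Rightarrow> elements" where
  "element_action n a b c d \<kappa> \<mu> \<nu> \<xi> = (\<lambda>(v, w).
     ((\<lambda>k\<in>{1..n}. (a * v k + b) / (c * v k + d)),
      (\<lambda>k\<in>{1..n}. (\<kappa> + \<mu> * v k + \<nu> * v k ^ 2 + \<xi> * v k ^ 3 + (a * d - b * c) * w k)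
                      / (c * v k + d) ^ 3)))"

text \<open>
  Invariants may be defined only on part of the space of element systems (e.g. away from poles),
  hence the domain \<open>D\<close>, which need not be stable under the group.
\<close>

definition absolute_invariant :: "nat \<Rightarrow> elements set \<Rightarrow> (elements \<Rightarrow> complex) \<Rightarrow> bool" where
  "absolute_invariant n D F \<longleftrightarrow>
     (\<forall>(v, w)\<in>D. \<forall>a b c d \<kappa> \<mu> \<nu> \<xi>.
        a * d - b * c \<noteq> 0 \<longrightarrow> (\<forall>k\<in>{1..n}. c * v k + d \<noteq> 0) \<longrightarrow>
        element_action n a b c d \<kappa> \<mu> \<nu> \<xi> (v, w) \<in> D \<longrightarrow>
        F (element_action n a b c d \<kappa> \<mu> \<nu> \<xi> (v, w)) = F (v, w))"

definition xi_ratio :: "(nat \<Rightarrow> complex) \<Rightarrow> nat \<Rightarrow> complex" where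
  "xi_ratio v i = (v i - v 1) / (v 2 - v 1)"

definition eta_ratio :: "(nat \<Rightarrow> complex) \<Rightarrow> nat \<Rightarrow> complex" where
  "eta_ratio w i = (w i - w 1) / (w 2 - w 1)"

definition s_ratio :: "(nat \<Rightarrow> complex) \<Rightarrow> (nat \<Rightarrow> complex) \<Rightarrow> nat \<Rightarrow> complex" where
  "s_ratio v w i = eta_ratio w i / xi_ratio v i ^ 3"

definition r_inv :: "(nat \<Rightarrow> complex) \<Rightarrow> nat \<Rightarrow> complex" where
  "r_inv v j = xi_ratio v 3 * (xi_ratio v j - 1) / (xi_ratio v j * (xi_ratio v 3 - 1))"

definition sigma_ratio :: "(nat \<Rightarrow> complex) \<Rightarrow> (nat \<Rightarrow> complex) \<Rightarrow> nat \<Rightarrow> complex" where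
  "sigma_ratio v w j = (s_ratio v w j - 1) / (s_ratio v w 3 - 1)"

definition tau_ratio :: "(nat \<Rightarrow> complex) \<Rightarrow> (nat \<Rightarrow> complex) \<Rightarrow> nat \<Rightarrow> complex" where
  "tau_ratio v w j = (sigma_ratio v w j - r_inv v j) / (sigma_ratio v w 4 - r_inv v 4)"

definition omega_term :: "(nat \<Rightarrow> complex) \<Rightarrow> (nat \<Rightarrow> complex) \<Rightarrow> nat \<Rightarrow> complex" where
  "omega_term v w l = ((r_inv v 4)^2 - r_inv v 4) * tau_ratio v w l - ((r_inv v l)^2 - r_inv v l)"

definition Omega_inv :: "(nat \<Rightarrow> complex) \<Rightarrow> (nat \<Rightarrow> complex) \<Rightarrow> nat \<Rightarrow> complex" where
  "Omega_inv v w l = omega_term v w l / omega_term v w 5"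

text \<open>
  General position: the directions are pairwise distinct and no denominator in the definitions
  above vanishes.  The last condition, stating that the first five elements do not satisfy
  \<open>w = f v\<close> for one and the same polynomial \<open>f\<close> of degree at most three, is a genericity
  requirement already for \<open>n = 5\<close>, although no \<open>\<Omega>\<close> occurs there: five elements violating it form
  a union of exceptional orbits not separated by \<open>r\<^sub>4\<close> and \<open>r\<^sub>5\<close> from the generic ones.
\<close>

definition general_position :: "nat \<Rightarrow> elements set" where
  "general_position n = {(v, w). (v, w) \<in> element_systems n \<and>
     inj_on v {1..n} \<and> w 2 \<noteq> w 1 \<and> s_ratio v w 3 \<noteq> 1 \<and> sigma_ratio v w 4 \<noteq> r_inv v 4 \<and>
     (n \<ge> 5 \<longrightarrow> omega_term v w 5 \<noteq> 0)}"

definition involves_curvature :: "nat \<Rightarrow> (elements \<Rightarrow> complex) \<Rightarrow> bool" where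
  "involves_curvature n F \<longleftrightarrow>
     (\<exists>v w w'. (v, w) \<in> general_position n \<and> (v, w') \<in> general_position n \<and> F (v, w) \<noteq> F (v, w'))"

text \<open>
  Polynomial functions over \<open>\<complex>\<close> in the variables indexed by \<open>I\<close>.  As \<open>\<complex>\<close> is infinite, they may be
  identified with polynomials; the zero polynomial is the one vanishing identically.
\<close>

inductive polynomial_fun :: "'i set \<Rightarrow> (('i \<Rightarrow> complex) \<Rightarrow> complex) \<Rightarrow> bool" for I where
  const: "polynomial_fun I (\<lambda>x. c)"
| var: "i \<in> I \<Longrightarrow> polynomial_fun I (\<lambda>x. x i)"
| add: "polynomial_fun I p \<Longrightarrow> polynomial_fun I q \<Longrightarrow> polynomial_fun I (\<lambda>x. p x + q x)"
| mult: "polynomial_fun I p \<Longrightarrow> polynomial_fun I q \<Longrightarrow> polynomial_fun I (\<lambda>x. p x * q x)"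

text \<open>
  The variables \<open>v\<^sub>k, w\<^sub>k\<close>, and likewise \<open>r\<^sub>j, \<Omega>\<^sub>l\<close>, are indexed by a disjoint sum:
  \<open>Inl k\<close> stands for \<open>v\<^sub>k\<close> (resp. \<open>r\<^sub>k\<close>) and \<open>Inr k\<close> for \<open>w\<^sub>k\<close> (resp. \<open>\<Omega>\<^sub>k\<close>).
\<close>

definition element_coords :: "elements \<Rightarrow> nat + nat \<Rightarrow> complex" where
  "element_coords = (\<lambda>(v, w). case_sum v w)"

definition fundamental_coords :: "elements \<Rightarrow> nat + nat \<Rightarrow> complex" where
  "fundamental_coords = (\<lambda>(v, w). case_sum (r_inv v) (Omega_inv v w))"

definition r_family :: "nat \<Rightarrow> (elements \<Rightarrow> complex) set" where
  "r_family n = (\<lambda>j. \<lambda>(v, w)\<in>general_position n. r_inv v j) ` {4..n}"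

definition Omega_family :: "nat \<Rightarrow> (elements \<Rightarrow> complex) set" where
  "Omega_family n = (\<lambda>l. \<lambda>(v, w)\<in>general_position n. Omega_inv v w l) ` {6..n}"

end

theory Submission
  imports Defs
begin

text \<open>
  Let \<open>E\<^sub>l\<close> (\<open>defect v w l\<close>) be the amount by which \<open>w\<^sub>l\<close> deviates from the cubic in \<open>v\<close> interpolating the first four
  elements.  It is linear in \<open>w\<close>, kills \<open>\<kappa> + \<mu> v + \<nu> v\<^sup>2 + \<xi> v\<^sup>3\<close>, and is a relative invariant of
  the group: it is multiplied by \<open>(a d - b c) / (c v\<^sub>l + d)\<^sup>3\<close>.  Up to a factor that does not depend on
  \<open>l\<close>, the numerator of \<open>\<Omega>\<^sub>l\<close> is \<open>E\<^sub>l / (v\<^sub>l - v\<^sub>1)\<^sup>3\<close>, so \<open>\<Omega>\<^sub>l\<close> is invariant.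

  Conversely, if two systems have the same \<open>r\<^sub>j\<close>, a Moebius transformation \<open>(a v + b) / (c v + d)\<close>
  carries the directions of one to those of the other.  If they also have the same \<open>\<Omega>\<^sub>l\<close>, then rescaling
  \<open>(a, b, c, d)\<close> makes all deviations \<open>E\<^sub>5, E\<^sub>6, \<dots>\<close> agree, and the remaining discrepancy of the \<open>w\<^sub>k\<close>
  is a cubic in \<open>v\<close>.  Hence the systems lie in one orbit.

  For a rational invariant \<open>P / Q\<close>, fix a system \<open>e\<close> in general position with \<open>Q e \<noteq> 0\<close>.  Keeping
  \<open>v\<^sub>1, v\<^sub>2, v\<^sub>3\<close> and \<open>w\<^sub>1, \<dots>, w\<^sub>5\<close> fixed and solving for the other quantities gives a rational section
  of the invariants through \<open>e\<close>; substituting it into \<open>P / Q\<close> expresses the invariant rationally.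
\<close>

section \<open>Cubic interpolation\<close>

definition lagrange_basis :: "complex \<Rightarrow> complex \<Rightarrow> complex \<Rightarrow> complex \<Rightarrow> complex \<Rightarrow> complex" where
  "lagrange_basis a b c d x = (x - b) * (x - c) * (x - d) / ((a - b) * (a - c) * (a - d))"

definition interpolant :: "(nat \<Rightarrow> complex) \<Rightarrow> (nat \<Rightarrow> complex) \<Rightarrow> complex \<Rightarrow> complex" where
  "interpolant v h x =
     h 1 * lagrange_basis (v 1) (v 2) (v 3) (v 4) x + h 2 * lagrange_basis (v 2) (v 1) (v 3) (v 4) x +
     h 3 * lagrange_basis (v 3) (v 1) (v 2) (v 4) x + h 4 * lagrange_basis (v 4) (v 1) (v 2) (v 3) x"

definition defect :: "(nat \<Rightarrow> complex) \<Rightarrow> (nat \<Rightarrow> complex) \<Rightarrow> nat \<Rightarrow> complex" where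
  "defect v h l = h l - interpolant v h (v l)"

lemma lagrange_basis_cubic:
  "\<exists>\<kappa> \<mu> \<nu> \<xi>. \<forall>x. lagrange_basis a b c d x = \<kappa> + \<mu> * x + \<nu> * x ^ 2 + \<xi> * x ^ 3"
proof -
  \<comment> \<open>With the inverse of the denominator as an opaque factor \<open>m\<close> the
    claim is a polynomial identity, so coinciding nodes need no separate case.\<close>
  define m where "m = inverse ((a - b) * (a - c) * (a - d))"
  have "lagrange_basis a b c d x =
      - b * c * d * m + (b * c + b * d + c * d) * m * x + (- (b + c + d) * m) * x ^ 2 + m * x ^ 3" for x
    unfolding lagrange_basis_def divide_inverse m_def[symmetric] by algebra
  then show ?thesis by blast
qed

text \<open>Up to a common factor, these coefficients become the parameters
  \<open>\<kappa> \<mu> \<nu> \<xi>\<close> of the transformation built in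
  \<open>same_orbit\<close>.\<close>

lemma interpolant_cubic:
  "\<exists>\<kappa> \<mu> \<nu> \<xi>. \<forall>x. interpolant v h x = \<kappa> + \<mu> * x + \<nu> * x ^ 2 + \<xi> * x ^ 3"
proof -
  obtain k1 m1 n1 x1 where 1: "\<And>x. lagrange_basis (v 1) (v 2) (v 3) (v 4) x = k1 + m1 * x + n1 * x ^ 2 + x1 * x ^ 3"
    using lagrange_basis_cubic by metis
  obtain k2 m2 n2 x2 where 2: "\<And>x. lagrange_basis (v 2) (v 1) (v 3) (v 4) x = k2 + m2 * x + n2 * x ^ 2 + x2 * x ^ 3"
    using lagrange_basis_cubic by metis
  obtain k3 m3 n3 x3 where 3: "\<And>x. lagrange_basis (v 3) (v 1) (v 2) (v 4) x = k3 + m3 * x + n3 * x ^ 2 + x3 * x ^ 3"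
    using lagrange_basis_cubic by metis
  obtain k4 m4 n4 x4 where 4: "\<And>x. lagrange_basis (v 4) (v 1) (v 2) (v 3) x = k4 + m4 * x + n4 * x ^ 2 + x4 * x ^ 3"
    using lagrange_basis_cubic by metis
  have "interpolant v h x = (h 1 * k1 + h 2 * k2 + h 3 * k3 + h 4 * k4)
      + (h 1 * m1 + h 2 * m2 + h 3 * m3 + h 4 * m4) * x
      + (h 1 * n1 + h 2 * n2 + h 3 * n3 + h 4 * n4) * x ^ 2
      + (h 1 * x1 + h 2 * x2 + h 3 * x3 + h 4 * x4) * x ^ 3" for x
    unfolding interpolant_def 1 2 3 4 by (simp add: algebra_simps)
  then show ?thesis by blast
qed

lemma lagrange_basis_node [simp]:
  "lagrange_basis a b c d b = 0" "lagrange_basis a b c d c = 0" "lagrange_basis a b c d d = 0"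
  "a \<noteq> b \<Longrightarrow> a \<noteq> c \<Longrightarrow> a \<noteq> d \<Longrightarrow> lagrange_basis a b c d a = 1"
  by (simp_all add: lagrange_basis_def)

lemma interpolant_node:
  assumes "inj_on v {1..4}" "k \<in> {1..4}"
  shows "interpolant v h (v k) = h k"
proof -
  have "v 1 \<noteq> v 2" "v 1 \<noteq> v 3" "v 1 \<noteq> v 4" "v 2 \<noteq> v 3" "v 2 \<noteq> v 4" "v 3 \<noteq> v 4"
    using assms(1) by (auto dest: inj_onD)
  moreover have "k = 1 \<or> k = 2 \<or> k = 3 \<or> k = 4"
    using assms(2) by auto
  ultimately show ?thesis
    by (elim disjE) (simp_all add: interpolant_def eq_commute)
qed

text \<open>Divided differences: subtracting the equations at two nodes and cancelling the
  difference of the nodes lowers the degree by one. After three rounds the coefficients vanish from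
  the top down.\<close>

lemma cubic_eq_0:
  fixes a b c d :: complex
  assumes d: "a \<noteq> b" "a \<noteq> c" "a \<noteq> d" "b \<noteq> c" "b \<noteq> d" "c \<noteq> d"
    and z: "\<And>x. x \<in> {a, b, c, d} \<Longrightarrow> \<kappa> + \<mu> * x + \<nu> * x ^ 2 + \<xi> * x ^ 3 = 0"
  shows "\<kappa> + \<mu> * y + \<nu> * y ^ 2 + \<xi> * y ^ 3 = 0"
proof -
  have e1: "\<mu> + \<nu> * (a + x) + \<xi> * (a ^ 2 + a * x + x ^ 2) = 0" if "x \<in> {b, c, d}" for x
  proof -
    have "(x - a) * (\<mu> + \<nu> * (a + x) + \<xi> * (a ^ 2 + a * x + x ^ 2)) = 0"
      using z[of a] z[of x] that by (simp, algebra)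
    then show ?thesis using d that by auto
  qed
  have e2: "\<nu> + \<xi> * (a + b + x) = 0" if "x \<in> {c, d}" for x
  proof -
    have "(x - b) * (\<nu> + \<xi> * (a + b + x)) = 0"
      using e1[of b] e1[of x] that by (simp, algebra)
    then show ?thesis using d that by auto
  qed
  have "(d - c) * \<xi> = 0"
    using e2[of c] e2[of d] by (simp, algebra)
  then have x: "\<xi> = 0" using d by simp
  with e2[of c] have n: "\<nu> = 0" by simp
  with x e1[of b] have m: "\<mu> = 0" by simp
  with x n z[of a] show ?thesis by simp
qed

text \<open>Uniqueness of interpolation: the difference of the two cubics vanishes at four distinct
  nodes. This is what makes \<open>defect\<close> blind to the cubic terms of the group.\<close>

lemma interpolant_of_cubic:
  assumes inj: "inj_on v {1..4}" and h: "\<And>k. k \<in> {1..4} \<Longrightarrow> h k = \<kappa> + \<mu> * v k + \<nu> * v k ^ 2 + \<xi> * v k ^ 3"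
  shows "interpolant v h x = \<kappa> + \<mu> * x + \<nu> * x ^ 2 + \<xi> * x ^ 3"
proof -
  have d: "v 1 \<noteq> v 2" "v 1 \<noteq> v 3" "v 1 \<noteq> v 4" "v 2 \<noteq> v 3" "v 2 \<noteq> v 4" "v 3 \<noteq> v 4"
    using inj by (auto dest: inj_onD)
  obtain k m n z where i: "\<And>x. interpolant v h x = k + m * x + n * x ^ 2 + z * x ^ 3"
    using interpolant_cubic by metis
  have "(k - \<kappa>) + (m - \<mu>) * x + (n - \<nu>) * x ^ 2 + (z - \<xi>) * x ^ 3 = 0"
  proof (rule cubic_eq_0[OF d])
    fix y assume "y \<in> {v 1, v 2, v 3, v 4}"
    then obtain j where j: "j \<in> {1..4}" "y = v j"
      using that[of 1] that[of 2] that[of 3] that[of 4] by auto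
    show "(k - \<kappa>) + (m - \<mu>) * y + (n - \<nu>) * y ^ 2 + (z - \<xi>) * y ^ 3 = 0"
      using interpolant_node[OF inj j(1), of h] h[OF j(1)] i[of y] j(2)
      by (simp add: algebra_simps)
  qed
  then show ?thesis by (simp add: i algebra_simps)
qed

lemma interpolant_linear:
  "interpolant v (\<lambda>k. \<alpha> * f k + \<beta> * g k) x = \<alpha> * interpolant v f x + \<beta> * interpolant v g x"
  by (simp add: interpolant_def algebra_simps)

lemma defect_linear:
  "defect v (\<lambda>k. \<alpha> * f k + \<beta> * g k) l = \<alpha> * defect v f l + \<beta> * defect v g l"
  by (simp add: defect_def interpolant_linear algebra_simps)

section \<open>Interpolation under Moebius transformations\<close>

lemma mobius_diff:
  fixes a b c d x y :: complex
  assumes "c * x + d \<noteq> 0" "c * y + d \<noteq> 0"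
  shows "(a * x + b) / (c * x + d) - (a * y + b) / (c * y + d) =
    (a * d - b * c) * (x - y) / ((c * x + d) * (c * y + d))"
proof -
  have "(a * x + b) * (c * y + d) - (a * y + b) * (c * x + d) = (a * d - b * c) * (x - y)"
    by algebra
  then show ?thesis using assms by (simp add: diff_frac_eq)
qed

text \<open>When every difference is rewritten by \<open>m\<close>, the three factors
  \<open>D\<close> and the values of \<open>q\<close> at \<open>b\<close>, \<open>c\<close>,
  \<open>d\<close> cancel; what remains is \<open>(q a / q x) ^ 3\<close>.\<close>

lemma lagrange_basis_mobius:
  fixes m q :: "complex \<Rightarrow> complex"
  assumes D: "D \<noteq> 0" and q: "q a \<noteq> 0" "q b \<noteq> 0" "q c \<noteq> 0" "q d \<noteq> 0" "q x \<noteq> 0"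
    and m: "\<And>y z. q y \<noteq> 0 \<Longrightarrow> q z \<noteq> 0 \<Longrightarrow> m y - m z = D * (y - z) / (q y * q z)"
  shows "lagrange_basis (m a) (m b) (m c) (m d) (m x) * q x ^ 3 = q a ^ 3 * lagrange_basis a b c d x"
\<comment> \<open>If \<open>a\<close> equals another node, both sides are 0 by the convention for
  division by zero.\<close>
proof (cases "a = b \<or> a = c \<or> a = d")
  case False
  then show ?thesis
    using D q by (simp add: lagrange_basis_def m power3_eq_cube mult_ac)
qed (auto simp: lagrange_basis_def)

text \<open>The factor \<open>(c * v k + d) ^ 3\<close> that a basis polynomial acquires is absorbed
  into the value at its node: cubics transform as forms of weight three.\<close>

lemma defect_mobius:
  fixes a b c d :: complex
  defines "m \<equiv> (\<lambda>x. (a * x + b) / (c * x + d))"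
  assumes D: "a * d - b * c \<noteq> 0" and q: "\<And>k. k \<in> insert l {1..4} \<Longrightarrow> c * v k + d \<noteq> 0"
  shows "(c * v l + d) ^ 3 * defect (\<lambda>k. m (v k)) h l = defect v (\<lambda>k. (c * v k + d) ^ 3 * h k) l"
proof -
  have m: "m y - m z = (a * d - b * c) * (y - z) / ((c * y + d) * (c * z + d))"
    if "c * y + d \<noteq> 0" "c * z + d \<noteq> 0" for y z
    using mobius_diff[OF that] by (simp add: m_def)
  have L: "lagrange_basis (m (v i)) (m (v j)) (m (v k)) (m (v p)) (m (v l)) * (c * v l + d) ^ 3
      = (c * v i + d) ^ 3 * lagrange_basis (v i) (v j) (v k) (v p) (v l)"
    if "i \<in> {1..4}" "j \<in> {1..4}" "k \<in> {1..4}" "p \<in> {1..4}" for i j k p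
    by (rule lagrange_basis_mobius[OF D, where q = "\<lambda>x. c * x + d"]) (use q that m in auto)
  have "interpolant (\<lambda>k. m (v k)) h (m (v l)) * (c * v l + d) ^ 3
      = interpolant v (\<lambda>k. (c * v k + d) ^ 3 * h k) (v l)"
    unfolding interpolant_def
    using L[of 1 2 3 4] L[of 2 1 3 4] L[of 3 1 2 4] L[of 4 1 2 3]
    by (simp del: One_nat_def) algebra
  then show ?thesis by (simp add: defect_def algebra_simps)
qed

lemma general_positionD:
  assumes "(v, w) \<in> general_position n" "n \<ge> 4"
  shows "inj_on v {1..n}" "w 2 \<noteq> w 1" "s_ratio v w 3 \<noteq> 1" "sigma_ratio v w 4 \<noteq> r_inv v 4"
    "n \<ge> 5 \<Longrightarrow> omega_term v w 5 \<noteq> 0"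
    "\<And>i j. i \<in> {1..n} \<Longrightarrow> j \<in> {1..n} \<Longrightarrow> i \<noteq> j \<Longrightarrow> v i \<noteq> v j"
    "(v, w) \<in> element_systems n"
  using assms by (auto simp: general_position_def dest: inj_onD)

section \<open>The numerator of \<Omega> as a multiple of the defect\<close>

lemma r_inv_eq:
  assumes "v 1 \<noteq> v 2" "v 2 \<noteq> v 3"  "v j \<noteq> v 1"
  shows "r_inv v j = (v 3 - v 1) * (v j - v 2) / ((v j - v 1) * (v 3 - v 2))"
proof -
  have 1: "xi_ratio v i - 1 = (v i - v 2) / (v 2 - v 1)" for i
    using assms by (simp add: xi_ratio_def field_simps)
  show ?thesis unfolding r_inv_def 1 
    using assms by (simp add: xi_ratio_def)
qed

lemma r_inv_minus_1:
  assumes "v 1 \<noteq> v 2" "v 2 \<noteq> v 3" "v j \<noteq> v 1"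
  shows "r_inv v j - 1 = (v j - v 3) * (v 2 - v 1) / ((v j - v 1) * (v 3 - v 2))"
  using assms unfolding r_inv_eq[OF assms] by (simp add: divide_simps, simp add: algebra_simps)

lemma r_inv_quadratic:
  assumes "v 1 \<noteq> v 2" "v 2 \<noteq> v 3" "v j \<noteq> v 1"
  shows "(r_inv v j)\<^sup>2 - r_inv v j =
    (v 3 - v 1) * (v 2 - v 1) * (v j - v 2) * (v j - v 3) / ((v j - v 1)\<^sup>2 * (v 3 - v 2)\<^sup>2)"
proof -
  have "(r_inv v j)\<^sup>2 - r_inv v j = r_inv v j * (r_inv v j - 1)"
    by (simp add: power2_eq_square algebra_simps)
  also have "\<dots> = (v 3 - v 1) * (v 2 - v 1) * (v j - v 2) * (v j - v 3) / ((v j - v 1)\<^sup>2 * (v 3 - v 2)\<^sup>2)"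
    unfolding r_inv_minus_1[OF assms] unfolding r_inv_eq[OF assms] by (simp add: power2_eq_square mult_ac)
  finally show ?thesis .
qed

lemma lagrange_basis_scaled:
  "lagrange_basis (x + a) (x + b) (x + c) (x + d) (x + y) = lagrange_basis a b c d y"
  by (simp add: lagrange_basis_def)

text \<open>Here \<open>e\<close>, \<open>p\<close>, \<open>q\<close>, \<open>y\<close> stand for
  the directions 2, 3, 4, \<open>l\<close> measured from \<open>v 1\<close>; \<open>r\<close> is
  then the cross-ratio and \<open>R t\<close> is \<open>r t * (r t - 1)\<close>. The identities
  match, for the curvatures 4, 3, 2 in this order, the coefficient in the defect with that in the
  numerator of \<Omega>.\<close>

lemma omega_coefficients:
  fixes e p q y :: complex
  defines "r \<equiv> \<lambda>t. p * (t - e) / (t * (p - e))"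
  defines "R \<equiv> \<lambda>t. p * e * (t - e) * (t - p) / (t\<^sup>2 * (p - e)\<^sup>2)"
  assumes nz: "e \<noteq> 0" "p \<noteq> 0" "q \<noteq> 0" "y \<noteq> 0" "p \<noteq> e" "q \<noteq> e" "q \<noteq> p" "y \<noteq> e" "y \<noteq> p" "y \<noteq> q"
  shows "R q * (e / y) ^ 3 * lagrange_basis q 0 e p y = R y * (e / q) ^ 3"
    and "R q * (e / y) ^ 3 * lagrange_basis p 0 e q y = (R q * r y - R y * r q) * (e / p) ^ 3"
    and "R q * (e / y) ^ 3 * lagrange_basis e 0 p q y = R q - R y - R q * r y + R y * r q"
proof -
  define qe qp ye yp qy s where atoms: "qe = q - e" "qp = q - p" "ye = y - e" "yp = y - p" "qy = q - y" "s = p - e"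
  have at0: "qe \<noteq> 0" "qp \<noteq> 0" "ye \<noteq> 0" "yp \<noteq> 0" "qy \<noteq> 0" "s \<noteq> 0"
    using nz by (auto simp: atoms)
  have diffs: "q - e = qe" "q - p = qp" "y - e = ye" "y - p = yp" "p - e = s"
    "p - q = - qp" "y - q = - qy" "e - p = - s" "e - q = - qe"
    by (simp_all add: atoms)
  have r: "r q = p * qe / (q * s)" "r y = p * ye / (y * s)"
    by (simp_all add: r_def atoms)
  have r1: "r q - 1 = e * qp / (q * s)" "r y - 1 = e * yp / (y * s)"
    using nz at0(6) unfolding r by (simp_all add: diff_divide_eq_iff divide_diff_eq_iff atoms) (simp_all add: algebra_simps)
  have rr: "r q - r y = p * e * qy / (q * y * s)"
    using nz at0(6) unfolding r by (simp add: divide_simps) (simp add: atoms algebra_simps)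
  have R: "R q = p * e * qe * qp / (q\<^sup>2 * s\<^sup>2)" "R y = p * e * ye * yp / (y\<^sup>2 * s\<^sup>2)"
    by (simp_all add: R_def atoms)
  have R': "R q = r q * (r q - 1)" "R y = r y * (r y - 1)"
    unfolding R r1 unfolding r by (simp_all add: power2_eq_square mult_ac)
  show "R q * (e / y) ^ 3 * lagrange_basis q 0 e p y = R y * (e / q) ^ 3"
    unfolding R lagrange_basis_def diffs using nz(1-4) at0
    by (simp add: power2_eq_square power3_eq_cube mult_ac)
  have "R q * r y - R y * r q = r q * r y * (r q - r y)"
    unfolding R' by (simp add: algebra_simps)
  also have "\<dots> * (e / p) ^ 3 = R q * (e / y) ^ 3 * lagrange_basis p 0 e q y"
    unfolding rr unfolding R r lagrange_basis_def diffs using nz(1-4) at0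
    by (simp add: power2_eq_square power3_eq_cube mult_ac)
  finally show "R q * (e / y) ^ 3 * lagrange_basis p 0 e q y = (R q * r y - R y * r q) * (e / p) ^ 3"
    by simp
  have "R q - R y - R q * r y + R y * r q = - ((r q - 1) * (r y - 1) * (r q - r y))"
    unfolding R' by (simp add: algebra_simps)
  also have "\<dots> = R q * (e / y) ^ 3 * lagrange_basis e 0 p q y"
    unfolding rr r1 unfolding R lagrange_basis_def diffs using nz(1-4) at0
    by (simp add: power2_eq_square power3_eq_cube mult_ac)
  finally show "R q * (e / y) ^ 3 * lagrange_basis e 0 p q y = R q - R y - R q * r y + R y * r q"
    by simp
qed

text \<open>Once the denominators of \<open>s\<close>, \<sigma>, \<tau> are cleared, both sides are
  linear in \<open>w k - w 1\<close> for \<open>k\<close> = 2, 3, 4, \<open>l\<close>. The first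
  three coefficients agree by \<open>omega_coefficients\<close>, and that of \<open>l\<close> is the
  factor in front of the defect.\<close>

lemma omega_term_defect:
  assumes inj: "inj_on v {1..4}" and l: "\<And>i. i \<in> {1..4} \<Longrightarrow> v l \<noteq> v i"
    and w: "w 2 \<noteq> w 1" "s_ratio v w 3 \<noteq> 1" "sigma_ratio v w 4 \<noteq> r_inv v 4"
  shows "omega_term v w l * ((sigma_ratio v w 4 - r_inv v 4) * (s_ratio v w 3 - 1) * (w 2 - w 1)) =
    ((r_inv v 4)\<^sup>2 - r_inv v 4) / xi_ratio v l ^ 3 * defect v w l"
proof -
  have d: "v 1 \<noteq> v 2" "v 1 \<noteq> v 3" "v 1 \<noteq> v 4" "v 2 \<noteq> v 3" "v 2 \<noteq> v 4" "v 3 \<noteq> v 4"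
    using inj by (auto dest: inj_onD)
  have dl: "v l \<noteq> v 1" "v l \<noteq> v 2" "v l \<noteq> v 3" "v l \<noteq> v 4"
    using l by auto
  define A where "A = (r_inv v 4)\<^sup>2 - r_inv v 4"
  define B where "B = (r_inv v l)\<^sup>2 - r_inv v l"
  define T where "T i = (w i - w 1) / xi_ratio v i ^ 3" for i
  have T: "(w 2 - w 1) * (s_ratio v w i - 1) = T i - (w 2 - w 1)" for i
    using w(1) unfolding s_ratio_def eta_ratio_def T_def right_diff_distrib[of "w 2 - w 1"] by simp
  have om: "omega_term v w l * (sigma_ratio v w 4 - r_inv v 4) =
      A * (sigma_ratio v w l - r_inv v l) - B * (sigma_ratio v w 4 - r_inv v 4)"
    using w(3) by (simp add: omega_term_def tau_ratio_def A_def B_def field_simps)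
  have sg: "sigma_ratio v w i * (s_ratio v w 3 - 1) = s_ratio v w i - 1" for i
    using w(2) by (simp add: sigma_ratio_def)
  have "omega_term v w l * ((sigma_ratio v w 4 - r_inv v 4) * (s_ratio v w 3 - 1) * (w 2 - w 1)) =
    (omega_term v w l * (sigma_ratio v w 4 - r_inv v 4)) * (s_ratio v w 3 - 1) * (w 2 - w 1)"
    by simp
  also have "\<dots> = (A * ((s_ratio v w l - 1) - r_inv v l * (s_ratio v w 3 - 1))
      - B * ((s_ratio v w 4 - 1) - r_inv v 4 * (s_ratio v w 3 - 1))) * (w 2 - w 1)"
    unfolding sg[of l, symmetric] sg[of 4, symmetric] using om by algebra
  also have "\<dots> = A * ((T l - (w 2 - w 1)) - r_inv v l * (T 3 - (w 2 - w 1)))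
      - B * ((T 4 - (w 2 - w 1)) - r_inv v 4 * (T 3 - (w 2 - w 1)))"
    unfolding T[symmetric] by algebra
  also have "\<dots> = A / xi_ratio v l ^ 3 * defect v w l"
  proof -
    define e p q y where epqy: "e = v 2 - v 1" "p = v 3 - v 1" "q = v 4 - v 1" "y = v l - v 1"
    define h where "h k = w k - w 1" for k
    define R where "R t = p * e * (t - e) * (t - p) / (t\<^sup>2 * (p - e)\<^sup>2)" for t
    define r where "r t = p * (t - e) / (t * (p - e))" for t
    have nz: "e \<noteq> 0" "p \<noteq> 0" "q \<noteq> 0" "y \<noteq> 0" "p \<noteq> e" "q \<noteq> e" "q \<noteq> p" "y \<noteq> e" "y \<noteq> p" "y \<noteq> q"
      using d dl by (auto simp: epqy)
    note c = omega_coefficients[OF nz, folded R_def r_def]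
    have AB: "A = R q" "B = R y" "r_inv v 4 = r q" "r_inv v l = r y"
      using r_inv_quadratic[OF d(1,4) d(3)[symmetric]] r_inv_quadratic[OF d(1,4) dl(1)]
        r_inv_eq[OF d(1,4) d(3)[symmetric]] r_inv_eq[OF d(1,4) dl(1)]
      unfolding A_def B_def R_def r_def epqy by (simp_all del: One_nat_def)
    have TT: "T 3 = h 3 * (e / p) ^ 3" "T 4 = h 4 * (e / q) ^ 3" "T l = h l * (e / y) ^ 3"
      by (simp_all add: T_def h_def xi_ratio_def epqy power_divide del: One_nat_def)
    have vv: "v 2 = v 1 + e" "v 3 = v 1 + p" "v 4 = v 1 + q" "v l = v 1 + y"
      by (auto simp: epqy)
    \<comment> \<open>Interpolation reproduces constants, so subtracting \<open>w 1\<close> leaves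
      the defect unchanged and removes the term of the first node.\<close>
    have "interpolant v (\<lambda>k. 1) (v l) = 1"
      using interpolant_of_cubic[OF inj, of "\<lambda>k. 1" 1 0 0 0] by simp
    then have "defect v w l = defect v h l"
      using defect_linear[of v 1 w "- w 1" "\<lambda>k. 1" l] by (simp add: defect_def h_def[abs_def])
    also have "\<dots> = h l - (h 2 * lagrange_basis e 0 p q y + h 3 * lagrange_basis p 0 e q y
        + h 4 * lagrange_basis q 0 e p y)"
      unfolding defect_def interpolant_def vv
      using lagrange_basis_scaled[of "v 1" e 0 p q y] lagrange_basis_scaled[of "v 1" p 0 e q y]
        lagrange_basis_scaled[of "v 1" q 0 e p y] by (simp add: h_def)
    finally have D: "defect v w l = \<dots>" .
    have X: "A / xi_ratio v l ^ 3 = R q * (e / y) ^ 3"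
      by (simp add: AB xi_ratio_def epqy power_divide del: One_nat_def)
    have combine: "a * (lh * Y - h2 - r1 * (h3 * P - h2)) - b * (h4 * Q - h2 - r2 * (h3 * P - h2)) =
        a * Y * (lh - (h2 * l2 + h3 * l3 + h4 * l4))"
      if "a * Y * l4 = b * Q" "a * Y * l3 = (a * r1 - b * r2) * P" "a * Y * l2 = a - b - a * r1 + b * r2"
      for a b lh Y h2 h3 h4 r1 r2 P Q l2 l3 l4 :: complex
    proof -
      have "a * Y * (lh - (h2 * l2 + h3 * l3 + h4 * l4)) =
          a * Y * lh - h2 * (a * Y * l2) - h3 * (a * Y * l3) - h4 * (a * Y * l4)"
        by (simp add: algebra_simps)
      then show ?thesis unfolding that by (simp add: algebra_simps)
    qed
    show ?thesis
      unfolding D X unfolding AB TT h_def[of 2, symmetric] by (rule combine[OF c])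
  qed
  finally show ?thesis by (simp add: A_def)
qed

section \<open>Invariance and orbits\<close>

text \<open>The factors in \<open>omega_term_defect\<close> that do not depend on \<open>l\<close>
  cancel in the quotient. That \<open>omega_term v w 5\<close> is non-zero forces the fifth defect
  to be non-zero.\<close>

lemma Omega_inv_defect:
  assumes gp: "(v, w) \<in> general_position n" and l: "l \<in> {5..n}"
  shows "Omega_inv v w l = defect v w l / defect v w 5 * ((v 5 - v 1) / (v l - v 1)) ^ 3"
    and "defect v w 5 \<noteq> 0"
proof -
  have n: "n \<ge> 5" "n \<ge> 4" using l by auto
  note g = general_positionD[OF gp n(2)]
  have inj: "inj_on v {1..4}" by (rule inj_on_subset[OF g(1)]) (use n in auto)
  define C where "C = (sigma_ratio v w 4 - r_inv v 4) * (s_ratio v w 3 - 1) * (w 2 - w 1)"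
  define A where "A = (r_inv v 4)\<^sup>2 - r_inv v 4"
  have C: "C \<noteq> 0" using g by (simp add: C_def)
  have o: "omega_term v w k * C = A / xi_ratio v k ^ 3 * defect v w k" if "k \<in> {5..n}" for k
    unfolding C_def A_def using that n by (intro omega_term_defect inj g) auto
  have ne: "v 1 \<noteq> v 2" "v l \<noteq> v 1" "v 5 \<noteq> v 1"
    using l by (simp_all add: inj_on_eq_iff[OF g(1)])
  have "omega_term v w 5 * C \<noteq> 0" using g(5) n C by simp
  then have nz: "A \<noteq> 0" "defect v w 5 \<noteq> 0"
    using o[of 5] n by auto
  show "defect v w 5 \<noteq> 0" by fact
  have "Omega_inv v w l = (omega_term v w l * C) / (omega_term v w 5 * C)"
    using C by (simp add: Omega_inv_def)
  also have "\<dots> = (A / xi_ratio v l ^ 3 * defect v w l) / (A / xi_ratio v 5 ^ 3 * defect v w 5)"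
    using o l n by simp
  also have "\<dots> = defect v w l / defect v w 5 * ((v 5 - v 1) / (v l - v 1)) ^ 3"
    using nz ne by (simp add: xi_ratio_def power_divide)
  finally show "Omega_inv v w l = \<dots>" .
qed

text \<open>In the form \<open>r_inv_eq\<close> each of the four directions occurs once above and
  once below the fraction bar, so the factors from \<open>mobius_diff\<close> cancel.\<close>

lemma r_inv_mobius:
  fixes a b c d :: complex
  assumes D: "a * d - b * c \<noteq> 0" and q: "\<And>k. k \<in> {1, 2, 3, j} \<Longrightarrow> c * v k + d \<noteq> 0"
    and m: "\<And>k. k \<in> {1, 2, 3, j} \<Longrightarrow> v' k = (a * v k + b) / (c * v k + d)"
    and ne: "v 1 \<noteq> v 2" "v 2 \<noteq> v 3" "v j \<noteq> v 1"
  shows "r_inv v' j = r_inv v j"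
proof -
  have df: "v' i - v' k = (a * d - b * c) * (v i - v k) / ((c * v i + d) * (c * v k + d))"
    if "i \<in> {1, 2, 3, j}" "k \<in> {1, 2, 3, j}" for i k
    using that by (simp add: m mobius_diff[OF q q])
  have ne': "v' i \<noteq> v' k" if "i \<in> {1, 2, 3, j}" "k \<in> {1, 2, 3, j}" "v i \<noteq> v k" for i k
  proof -
    have "v' i - v' k \<noteq> 0" 
      using df[OF that(1,2)] D q[OF that(1)] q[OF that(2)] that(3) by simp
    then show ?thesis by simp
  qed
  have "r_inv v' j = (v' 3 - v' 1) * (v' j - v' 2) / ((v' j - v' 1) * (v' 3 - v' 2))"
    using ne by (intro r_inv_eq ne') auto
  also have "\<dots> = (v 3 - v 1) * (v j - v 2) / ((v j - v 1) * (v 3 - v 2))"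
    using D q ne by (simp add: df)
  also have "\<dots> = r_inv v j"
    using ne by (intro r_inv_eq[symmetric])
  finally show ?thesis .
qed

text \<open>With denominators cleared, the new curvatures are a cubic in \<open>v\<close> plus
  \<open>a * d - b * c\<close> times the old ones. The cubic is its own interpolant and has defect
  0.\<close>

lemma defect_element_action:
  assumes D: "a * d - b * c \<noteq> 0" and q: "\<And>k. k \<in> {1..n} \<Longrightarrow> c * v k + d \<noteq> 0"
    and inj: "inj_on v {1..n}" and n: "n \<ge> 4" and l: "l \<in> {1..n}"
    and e: "element_action n a b c d \<kappa> \<mu> \<nu> \<xi> (v, w) = (v', w')"
  shows "(c * v l + d) ^ 3 * defect v' w' l = (a * d - b * c) * defect v w l"
proof -
  have v': "v' k = (a * v k + b) / (c * v k + d)" if "k \<in> {1..n}" for k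
    using e that by (auto simp: element_action_def)
  have w': "(c * v k + d) ^ 3 * w' k = (\<kappa> + \<mu> * v k + \<nu> * v k ^ 2 + \<xi> * v k ^ 3) + (a * d - b * c) * w k"
    if "k \<in> {1..n}" for k
  proof -
    have "w' = snd (element_action n a b c d \<kappa> \<mu> \<nu> \<xi> (v, w))" by (simp add: e)
    then have "w' k = (\<kappa> + \<mu> * v k + \<nu> * v k ^ 2 + \<xi> * v k ^ 3 + (a * d - b * c) * w k) / (c * v k + d) ^ 3"
      using that by (simp add: element_action_def)
    moreover have "(c * v k + d) ^ 3 \<noteq> 0" using q[OF that] by simp
    ultimately show ?thesis by (metis nonzero_mult_div_cancel_left times_divide_eq_right)
  qed
  have inj4: "inj_on v {1..4}" by (rule inj_on_subset[OF inj]) (use n in auto)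
  define p where "p x = \<kappa> + \<mu> * x + \<nu> * x ^ 2 + \<xi> * x ^ 3" for x
  have "(c * v l + d) ^ 3 * defect v' w' l =
      (c * v l + d) ^ 3 * defect (\<lambda>k. (a * v k + b) / (c * v k + d)) w' l"
    using l n by (simp add: defect_def v' interpolant_def)
  also have "\<dots> = defect v (\<lambda>k. (c * v k + d) ^ 3 * w' k) l"
    using l n by (intro defect_mobius D q) auto
  also have "\<dots> = defect v (\<lambda>k. 1 * p (v k) + (a * d - b * c) * w k) l"
    using l n by (simp add: defect_def w' interpolant_def p_def)
  also have "\<dots> = (a * d - b * c) * defect v w l"
    unfolding defect_linear
    using interpolant_of_cubic[OF inj4, of "\<lambda>k. p (v k)" \<kappa> \<mu> \<nu> \<xi> "v l"] by (simp add: defect_def p_def)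
  finally show ?thesis .
qed

lemma absolute_invariant_r:
  assumes n: "n \<ge> 4" and j: "j \<in> {4..n}"
  shows "absolute_invariant n (general_position n) (\<lambda>(v, w). r_inv v j)"
  unfolding absolute_invariant_def
proof clarify
  fix v w a b c d \<kappa> \<mu> \<nu> \<xi>
  assume gp: "(v, w) \<in> general_position n" and D: "a * d - b * c \<noteq> 0"
    and q: "\<forall>k\<in>{1..n}. c * v k + d \<noteq> 0"
  note g = general_positionD[OF gp n]
  obtain v' w' where e: "element_action n a b c d \<kappa> \<mu> \<nu> \<xi> (v, w) = (v', w')"
    by (metis surj_pair)
  have "r_inv v' j = r_inv v j"
  proof (rule r_inv_mobius[OF D])
    fix k assume "k \<in> {1, 2, 3, j}"
    then have k: "k \<in> {1..n}" using n j by auto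
    then show "c * v k + d \<noteq> 0" using q by blast
    show "v' k = (a * v k + b) / (c * v k + d)"
      using e k by (auto simp: element_action_def)
  qed (use n j in \<open>simp_all add: inj_on_eq_iff[OF g(1)]\<close>)
  then show "(case element_action n a b c d \<kappa> \<mu> \<nu> \<xi> (v, w) of (v, w) \<Rightarrow> r_inv v j) = r_inv v j"
    by (simp add: e)
qed

text \<open>The quotient of defects gains \<open>((c * v 5 + d) / (c * v l + d)) ^ 3\<close>; the
  quotient of direction differences gains the inverse ratio, which is then cubed.\<close>

lemma absolute_invariant_Omega:
  assumes l: "l \<in> {6..n}"
  shows "absolute_invariant n (general_position n) (\<lambda>(v, w). Omega_inv v w l)"
  unfolding absolute_invariant_def
proof clarify
  fix v w a b c d \<kappa> \<mu> \<nu> \<xi>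
  assume gp: "(v, w) \<in> general_position n" and D: "a * d - b * c \<noteq> 0"
    and q: "\<forall>k\<in>{1..n}. c * v k + d \<noteq> 0"
    and gp': "element_action n a b c d \<kappa> \<mu> \<nu> \<xi> (v, w) \<in> general_position n"
  have n: "n \<ge> 4" using l by auto
  note g = general_positionD[OF gp n]
  obtain v' w' where e: "element_action n a b c d \<kappa> \<mu> \<nu> \<xi> (v, w) = (v', w')"
    by (metis surj_pair)
  have O: "Omega_inv v w l = defect v w l / defect v w 5 * ((v 5 - v 1) / (v l - v 1)) ^ 3" 
    "defect v w 5 \<noteq> 0"
    using Omega_inv_defect[OF gp, of l] l by auto
  have O': "Omega_inv v' w' l = defect v' w' l / defect v' w' 5 * ((v' 5 - v' 1) / (v' l - v' 1)) ^ 3"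
    using Omega_inv_defect[OF gp'[unfolded e], of l] l by auto
  have t: "defect v' w' k = (a * d - b * c) * defect v w k / (c * v k + d) ^ 3" if "k \<in> {1..n}" for k
  proof -
    have "c * v k + d \<noteq> 0" using q that by auto
    then show ?thesis
      using defect_element_action[OF D _ g(1) n that e] q by (simp add: field_simps)
  qed
  have df: "v' k - v' 1 = (a * d - b * c) * (v k - v 1) / ((c * v k + d) * (c * v 1 + d))" if "k \<in> {1..n}" for k
    using e that q n mobius_diff[of c "v k" d "v 1"] by (auto simp: element_action_def)
  have "v l \<noteq> v 1" "v 5 \<noteq> v 1" using l by (simp_all add: inj_on_eq_iff[OF g(1)])
  moreover have "c * v l + d \<noteq> 0" "c * v 5 + d \<noteq> 0" "c * v 1 + d \<noteq> 0" using q l by auto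
  ultimately have "Omega_inv v' w' l = Omega_inv v w l"
    unfolding O(1) O' using l O(2) D by (simp add: t df power_divide power_mult_distrib del: One_nat_def)
  then show "(case element_action n a b c d \<kappa> \<mu> \<nu> \<xi> (v, w) of (v, w) \<Rightarrow> Omega_inv v w l) = Omega_inv v w l"
    by (simp add: e)
qed

section \<open>Orbits and functional completeness\<close>

lemma mobius_of_r_inv:
  assumes gp: "inj_on v {1..n}" "inj_on v' {1..n}" and n: "n \<ge> 4"
    and r: "\<And>j. j \<in> {4..n} \<Longrightarrow> r_inv v j = r_inv v' j"
  obtains a b c d where "a * d - b * c \<noteq> 0" "\<And>k. k \<in> {1..n} \<Longrightarrow> c * v k + d \<noteq> 0"
    "\<And>k. k \<in> {1..n} \<Longrightarrow> v' k = (a * v k + b) / (c * v k + d)"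
proof -
  have d: "v 1 \<noteq> v 2" "v 1 \<noteq> v 3" "v 2 \<noteq> v 3" "v' 1 \<noteq> v' 2" "v' 1 \<noteq> v' 3" "v' 2 \<noteq> v' 3"
    using n by (simp_all add: inj_on_eq_iff[OF gp(1)] inj_on_eq_iff[OF gp(2)])
  define p where "p = (v 3 - v 1) / (v 3 - v 2)"
  define p' where "p' = (v' 3 - v' 1) / (v' 3 - v' 2)"
  have p: "p \<noteq> 0" "p' \<noteq> 0" using d by (auto simp: p_def p'_def)
  \<comment> \<open>The cross-ratio is \<open>p * (x - v 2) / (x - v 1)\<close>. Equating it with
    its primed counterpart and solving for the primed direction yields these coefficients.\<close>
  define a where "a = p' * v' 2 - p * v' 1"
  define b where "b = p * v' 1 * v 2 - p' * v' 2 * v 1"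
  define c where "c = p' - p"
  define e where "e = p * v 2 - p' * v 1"
  have "a * e - b * c = p * p' * (v' 2 - v' 1) * (v 2 - v 1)"
    by (simp add: a_def b_def c_def e_def algebra_simps)
  then have D: "a * e - b * c \<noteq> 0" using p d by simp
  have eq: "v' k * (c * v k + e) = a * v k + b" if k: "k \<in> {1..n}" for k
  proof -
    \<comment> \<open>In this cleared form the equation also covers the three base directions, about
      which the hypothesis \<open>r\<close> says nothing.\<close>
    have "p' * (v' k - v' 2) * (v k - v 1) = p * (v k - v 2) * (v' k - v' 1)"
    proof -
      consider "k = 1" | "k = 2" | "k = 3" | "k \<in> {4..n}"
        using k unfolding atLeastAtMost_iff by linarith
      then show ?thesis
      proof cases
        case 3 then show ?thesis using d by (simp add: p_def p'_def)
      next
        case 4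
        then have k1: "v k \<noteq> v 1" "v' k \<noteq> v' 1"
          by (simp_all add: inj_on_eq_iff[OF gp(1)] inj_on_eq_iff[OF gp(2)])
        have "p * (v k - v 2) / (v k - v 1) = p' * (v' k - v' 2) / (v' k - v' 1)"
          using r[OF 4] d k1 by (simp add: r_inv_eq p_def p'_def mult_ac)
        then show ?thesis using k1 by (simp add: frac_eq_eq mult_ac)
      qed simp_all
    qed
    moreover have "v' k * (c * v k + e) - (a * v k + b) =
        p' * (v' k - v' 2) * (v k - v 1) - p * (v k - v 2) * (v' k - v' 1)"
      by (simp add: a_def b_def c_def e_def algebra_simps)
    ultimately show ?thesis by simp
  qed
  have q: "c * v k + e \<noteq> 0" if k: "k \<in> {1..n}" for k
  proof
    \<comment> \<open>By \<open>eq\<close> the numerator would vanish together with the denominator,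
      and so would the determinant.\<close>
    assume z: "c * v k + e = 0"
    then have "e = - c * v k" "b = - a * v k"
      using eq[OF k] by (simp_all add: add_eq_0_iff)
    with D show False by simp
  qed
  show ?thesis
    by (rule that[OF D q]) (use eq q in \<open>auto simp: eq_divide_eq\<close>)
qed

lemma same_orbit:
  assumes n: "n \<ge> 4" and gp: "(v, w) \<in> general_position n" "(v', w') \<in> general_position n"
    and r: "\<And>j. j \<in> {4..n} \<Longrightarrow> r_inv v j = r_inv v' j"
    and O: "\<And>l. l \<in> {6..n} \<Longrightarrow> Omega_inv v w l = Omega_inv v' w' l"
  obtains a b c d \<kappa> \<mu> \<nu> \<xi> where "a * d - b * c \<noteq> 0" "\<And>k. k \<in> {1..n} \<Longrightarrow> c * v k + d \<noteq> 0"
    "element_action n a b c d \<kappa> \<mu> \<nu> \<xi> (v, w) = (v', w')"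
proof -
  note g = general_positionD[OF gp(1) n] and g' = general_positionD[OF gp(2) n]
  obtain a b c d where D: "a * d - b * c \<noteq> 0" and q: "\<And>k. k \<in> {1..n} \<Longrightarrow> c * v k + d \<noteq> 0"
    and m: "\<And>k. k \<in> {1..n} \<Longrightarrow> v' k = (a * v k + b) / (c * v k + d)"
    by (rule mobius_of_r_inv[OF g(1) g'(1) n r]) (assumption, rule that)
  define \<Delta> where "\<Delta> = a * d - b * c"
  define Q where "Q k = c * v k + d" for k
  have Q: "Q k \<noteq> 0" if "k \<in> {1..n}" for k using q[OF that] by (simp add: Q_def)
  \<comment> \<open>\<open>h\<close> carries the target curvatures back to the source directions,
    where their defects can be compared with those of \<open>w\<close>.\<close>
  define h where "h k = Q k ^ 3 * w' k" for k
  have dh: "defect v h k = Q k ^ 3 * defect v' w' k" if "k \<in> {1..n}" for k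
  proof -
    have "defect v h k = Q k ^ 3 * defect (\<lambda>k. (a * v k + b) / (c * v k + d)) w' k"
      unfolding h_def Q_def using that n by (intro defect_mobius[symmetric] D q) auto
    then show ?thesis using that n by (simp add: defect_def m interpolant_def)
  qed
  obtain t where t: "t \<noteq> 0" "\<And>k. k \<in> {5..n} \<Longrightarrow> t * defect v h k = \<Delta> * defect v w k"
  proof (cases "n \<ge> 5")
    \<comment> \<open>Four elements leave no defect to match, so any non-zero scale will do.\<close>
    case False
    then show ?thesis using that[of 1] by simp
  next
    case True
    then have 5: "5 \<in> {5..n}" by simp
    have z: "defect v w 5 \<noteq> 0" "defect v' w' 5 \<noteq> 0"
      using Omega_inv_defect(2)[OF gp(1) 5] Omega_inv_defect(2)[OF gp(2) 5] by auto
    have z': "defect v h 5 \<noteq> 0" using dh[of 5] z Q True by simp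
    \<comment> \<open>This choice matches the fifth defect; equality of the \<Omega> extends the
      match to all later ones.\<close>
    define t where "t = \<Delta> * defect v w 5 / defect v h 5"
    have "t * defect v h k = \<Delta> * defect v w k" if k: "k \<in> {5..n}" for k
    proof -
      have "Omega_inv v w k = Omega_inv v' w' k"
      proof (cases "k = 5")
        case True
        then show ?thesis using g(5) g'(5) k by (simp add: Omega_inv_def)
      qed (use O k in auto)
      then have *: "defect v w k / defect v w 5 * ((v 5 - v 1) / (v k - v 1)) ^ 3 =
          defect v' w' k / defect v' w' 5 * ((v' 5 - v' 1) / (v' k - v' 1)) ^ 3"
        using Omega_inv_defect(1)[OF gp(1) k] Omega_inv_defect(1)[OF gp(2) k] by simp
      have df: "v' i - v' 1 = \<Delta> * (v i - v 1) / (Q i * Q 1)" if "i \<in> {1..n}" for i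
        using that n mobius_diff[OF q q, of i 1] m by (simp add: Q_def \<Delta>_def)
      have ne: "v k \<noteq> v 1" "v 5 \<noteq> v 1" using k by (simp_all add: inj_on_eq_iff[OF g(1)])
      have Qn: "Q k \<noteq> 0" "Q 5 \<noteq> 0" "Q 1 \<noteq> 0" using k by (auto intro!: Q)
      have "(v' 5 - v' 1) / (v' k - v' 1) = (v 5 - v 1) / (v k - v 1) * (Q k / Q 5)"
        using df[of 5] df[of k] k True D Qn by (simp add: \<Delta>_def)
      with * have "defect v w k / defect v w 5 * ((v 5 - v 1) / (v k - v 1)) ^ 3 =
          defect v' w' k / defect v' w' 5 * (Q k / Q 5) ^ 3 * ((v 5 - v 1) / (v k - v 1)) ^ 3"
        by (simp only: power_mult_distrib mult_ac)
      then have "defect v w k / defect v w 5 = defect v' w' k / defect v' w' 5 * (Q k / Q 5) ^ 3"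
        using ne by (subst (asm) mult_right_cancel) simp_all
      also have "\<dots> = defect v h k / defect v h 5"
        using k True by (simp add: dh power_divide mult.commute)
      finally show ?thesis
        using z z' by (simp add: t_def field_simps)
    qed
    moreover have "t \<noteq> 0" using z z' D by (simp add: t_def \<Delta>_def)
    ultimately show ?thesis using that by blast
  qed
  \<comment> \<open>The discrepancy \<open>u\<close> has zero defect from index 5 on, by the choice
    of \<open>t\<close>, and agrees with its interpolant at the first four nodes anyway. So it is a
    cubic in \<open>v\<close>.\<close>
  define u where "u k = t * h k + (- \<Delta>) * w k" for k
  obtain \<kappa> \<mu> \<nu> \<xi> where cub: "\<And>x. interpolant v u x = \<kappa> + \<mu> * x + \<nu> * x ^ 2 + \<xi> * x ^ 3"
    using interpolant_cubic by metis
  have inj4: "inj_on v {1..4}" by (rule inj_on_subset[OF g(1)]) (use n in auto)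
  have u: "u k = \<kappa> + \<mu> * v k + \<nu> * v k ^ 2 + \<xi> * v k ^ 3" if k: "k \<in> {1..n}" for k
  proof (cases "k \<le> 4")
    case True
    then show ?thesis using interpolant_node[OF inj4, of k u] k cub by simp
  next
    case False
    then have "defect v u k = 0" using t(2)[of k] k unfolding u_def defect_linear by simp
    then show ?thesis using cub by (simp add: defect_def)
  qed
  show ?thesis
  \<comment> \<open>Scaling \<open>a\<close>, \<open>b\<close>, \<open>c\<close>, \<open>d\<close>
    by \<open>t\<close> keeps the action on directions, multiplies the determinant by
    \<open>t ^ 2\<close> and the denominators of the curvatures by \<open>t ^ 3\<close>. The cubic
    therefore takes a factor \<open>t ^ 2\<close> as well.\<close>
  proof (rule that[of "t * a" "t * d" "t * b" "t * c"])
    have D': "t * a * (t * d) - t * b * (t * c) = t ^ 2 * \<Delta>" by (simp add: \<Delta>_def power2_eq_square algebra_simps)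
    then show "t * a * (t * d) - t * b * (t * c) \<noteq> 0" using t D by (simp add: \<Delta>_def)
    have q': "t * c * v k + t * d = t * Q k" for k by (simp add: Q_def algebra_simps)
    then show "t * c * v k + t * d \<noteq> 0" if "k \<in> {1..n}" for k using Q[OF that] t by simp
    have "v' \<in> extensional {1..n}" "w' \<in> extensional {1..n}"
      using g'(7) by (auto simp: element_systems_def PiE_def)
    moreover have "v' k = (t * a * v k + t * b) / (t * Q k)" if "k \<in> {1..n}" for k
      using m[OF that] t by (simp add: Q_def mult.assoc distrib_left[symmetric])
    moreover have "w' k = (t\<^sup>2 * \<kappa> + t\<^sup>2 * \<mu> * v k + t\<^sup>2 * \<nu> * v k ^ 2 + t\<^sup>2 * \<xi> * v k ^ 3 + t\<^sup>2 * \<Delta> * w k) / (t * Q k) ^ 3"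
      if "k \<in> {1..n}" for k
    proof -
      have "t\<^sup>2 * \<kappa> + t\<^sup>2 * \<mu> * v k + t\<^sup>2 * \<nu> * v k ^ 2 + t\<^sup>2 * \<xi> * v k ^ 3 + t\<^sup>2 * \<Delta> * w k =
          t\<^sup>2 * (u k + \<Delta> * w k)"
        by (simp add: u[OF that] algebra_simps)
      also have "\<dots> = (t * Q k) ^ 3 * w' k"
        by (simp add: u_def h_def power2_eq_square power3_eq_cube)
      finally show ?thesis using t Q[OF that] by simp
    qed
    ultimately show "element_action n (t * a) (t * b) (t * c) (t * d) (t\<^sup>2 * \<kappa>) (t\<^sup>2 * \<mu>) (t\<^sup>2 * \<nu>) (t\<^sup>2 * \<xi>) (v, w) = (v', w')"
      unfolding element_action_def prod.case D' q' 
      by (auto intro!: extensionalityI[where A = "{1..n}"])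
  qed
qed

lemma absolute_invariant_eq:
  assumes "n \<ge> 4" "absolute_invariant n D F" "D \<subseteq> general_position n" "(v, w) \<in> D" "(v', w') \<in> D"
    and "\<And>j. j \<in> {4..n} \<Longrightarrow> r_inv v j = r_inv v' j"
    and "\<And>l. l \<in> {6..n} \<Longrightarrow> Omega_inv v w l = Omega_inv v' w' l"
  shows "F (v, w) = F (v', w')"
proof -
  have "(v, w) \<in> general_position n" "(v', w') \<in> general_position n"
    using assms(3-5) by auto
  then show ?thesis
  proof (rule same_orbit[OF assms(1) _ _ assms(6,7)])
    fix a b c d \<kappa> \<mu> \<nu> \<xi>
    assume D: "a * d - b * c \<noteq> 0" and "\<And>k. k \<in> {1..n} \<Longrightarrow> c * v k + d \<noteq> 0"
      and e: "element_action n a b c d \<kappa> \<mu> \<nu> \<xi> (v, w) = (v', w')"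
    then have q: "\<forall>k\<in>{1..n}. c * v k + d \<noteq> 0" by blast
    \<comment> \<open>\<open>D\<close> need not be stable under the group: invariance is used for a
      single transformation whose end point lies in \<open>D\<close> by assumption.\<close>
    have "element_action n a b c d \<kappa> \<mu> \<nu> \<xi> (v, w) \<in> D" using assms(5) e by simp
    with bspec[OF assms(2)[unfolded absolute_invariant_def] assms(4), unfolded prod.case] D q
    have "F (element_action n a b c d \<kappa> \<mu> \<nu> \<xi> (v, w)) = F (v, w)" by blast
    then show ?thesis by (simp add: e)
  qed
qed

lemma functional_completeness:
  assumes "n \<ge> 4" "absolute_invariant n D F" "D \<subseteq> general_position n"
  shows "\<exists>\<Phi>. \<forall>(v, w)\<in>D. F (v, w) = \<Phi> (\<lambda>j\<in>{4..n}. r_inv v j) (\<lambda>l\<in>{6..n}. Omega_inv v w l)"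
proof -
  define \<iota> where "\<iota> = (\<lambda>(v, w). (\<lambda>j\<in>{4..n}. r_inv v j, \<lambda>l\<in>{6..n}. Omega_inv v w l))"
  have eq: "F e = F e'" if "e \<in> D" "e' \<in> D" "\<iota> e = \<iota> e'" for e e'
  proof -
    obtain v w v' w' where e: "e = (v, w)" "e' = (v', w')" by (metis surj_pair)
    have "r_inv v j = r_inv v' j" if "j \<in> {4..n}" for j
      using \<open>\<iota> e = \<iota> e'\<close> that unfolding e \<iota>_def by (auto dest: fun_cong[of _ _ j])
    moreover have "Omega_inv v w l = Omega_inv v' w' l" if "l \<in> {6..n}" for l
      using \<open>\<iota> e = \<iota> e'\<close> that unfolding e \<iota>_def by (auto dest: fun_cong[of _ _ l])
    ultimately show ?thesis using absolute_invariant_eq[OF assms] that unfolding e by blast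
  qed
  \<comment> \<open>\<open>F\<close> is constant on the fibres of \<open>\<iota>\<close>, so
    evaluating it at a chosen preimage in \<open>D\<close> defines \<Phi>.\<close>
  have "F (v, w) = F (inv_into D \<iota> (\<iota> (v, w)))" if "(v, w) \<in> D" for v w
    using that by (intro eq) (auto simp: inv_into_into f_inv_into_f)
  then show ?thesis
    by (intro exI[of _ "\<lambda>f g. F (inv_into D \<iota> (f, g))"]) (auto simp: \<iota>_def)
qed

section \<open>Rational functions near a point\<close>

text \<open>
  \<open>nearby\<close> is validity on a Zariski neighbourhood of \<open>a\<close>; \<open>regular_at\<close> is being given by a
  quotient of polynomials there.
\<close>

definition nearby :: "'i set \<Rightarrow> ('i \<Rightarrow> complex) \<Rightarrow> (('i \<Rightarrow> complex) \<Rightarrow> bool) \<Rightarrow> bool" where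
  "nearby I a C \<longleftrightarrow> (\<exists>B. polynomial_fun I B \<and> B a \<noteq> 0 \<and> (\<forall>x. B x \<noteq> 0 \<longrightarrow> C x))"

definition regular_at :: "'i set \<Rightarrow> ('i \<Rightarrow> complex) \<Rightarrow> (('i \<Rightarrow> complex) \<Rightarrow> complex) \<Rightarrow> bool" where
  "regular_at I a f \<longleftrightarrow> (\<exists>A B. polynomial_fun I A \<and> polynomial_fun I B \<and> B a \<noteq> 0 \<and>
     (\<forall>x. B x \<noteq> 0 \<longrightarrow> f x = A x / B x))"

lemma nearby_const: "C \<Longrightarrow> nearby I a (\<lambda>x. C)"
  unfolding nearby_def by (intro exI[of _ "\<lambda>x. 1"]) (auto intro: polynomial_fun.const)

lemma nearby_conj:
  assumes "nearby I a C" "nearby I a D"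
  shows "nearby I a (\<lambda>x. C x \<and> D x)"
proof -
  obtain A B where "polynomial_fun I A" "A a \<noteq> 0" "\<forall>x. A x \<noteq> 0 \<longrightarrow> C x"
    "polynomial_fun I B" "B a \<noteq> 0" "\<forall>x. B x \<noteq> 0 \<longrightarrow> D x"
    using assms unfolding nearby_def by blast
  then show ?thesis
    unfolding nearby_def by (intro exI[of _ "\<lambda>x. A x * B x"]) (auto intro: polynomial_fun.mult)
qed

lemma nearby_mono:
  assumes "nearby I a C" "\<And>x. C x \<Longrightarrow> D x"
  shows "nearby I a D"
  using assms unfolding nearby_def by blast

lemma nearby_Ball:
  assumes "finite S" "\<And>s. s \<in> S \<Longrightarrow> nearby I a (\<lambda>x. C s x)"
  shows "nearby I a (\<lambda>x. \<forall>s\<in>S. C s x)"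
  using assms
proof (induction S rule: finite_induct)
  case empty
  then show ?case by (simp add: nearby_const)
next
  case (insert s S)
  then have "nearby I a (\<lambda>x. C s x \<and> (\<forall>s\<in>S. C s x))"
    by (intro nearby_conj) auto
  then show ?case by simp
qed

lemma regular_at_const: "regular_at I a (\<lambda>x. c)"
  unfolding regular_at_def
  by (rule exI[of _ "\<lambda>x. c"], rule exI[of _ "\<lambda>x. 1"]) (auto intro: polynomial_fun.const)

lemma regular_at_var: "i \<in> I \<Longrightarrow> regular_at I a (\<lambda>x. x i)"
  unfolding regular_at_def
  by (rule exI[of _ "\<lambda>x. x i"], rule exI[of _ "\<lambda>x. 1"])
    (auto intro: polynomial_fun.const polynomial_fun.var)

lemma regular_at_add:
  assumes "regular_at I a f" "regular_at I a g"
  shows "regular_at I a (\<lambda>x. f x + g x)"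
proof -
  obtain A B where 1: "polynomial_fun I A" "polynomial_fun I B" "B a \<noteq> 0" "\<And>x. B x \<noteq> 0 \<Longrightarrow> f x = A x / B x"
    using assms(1) unfolding regular_at_def by blast
  obtain C D where 2: "polynomial_fun I C" "polynomial_fun I D" "D a \<noteq> 0" "\<And>x. D x \<noteq> 0 \<Longrightarrow> g x = C x / D x"
    using assms(2) unfolding regular_at_def by blast
  show ?thesis
    unfolding regular_at_def
  proof (rule exI[of _ "\<lambda>x. A x * D x + C x * B x"], rule exI[of _ "\<lambda>x. B x * D x"], intro conjI allI impI)
    show "polynomial_fun I (\<lambda>x. A x * D x + C x * B x)" "polynomial_fun I (\<lambda>x. B x * D x)"
      by (intro polynomial_fun.add polynomial_fun.mult 1(1,2) 2(1,2))+
    show "f x + g x = (A x * D x + C x * B x) / (B x * D x)" if "B x * D x \<noteq> 0" for x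
      using that 1(4)[of x] 2(4)[of x] by (simp add: add_frac_eq)
  qed (use 1 2 in simp)
qed

lemma regular_at_mult:
  assumes "regular_at I a f" "regular_at I a g"
  shows "regular_at I a (\<lambda>x. f x * g x)"
proof -
  obtain A B where 1: "polynomial_fun I A" "polynomial_fun I B" "B a \<noteq> 0" "\<And>x. B x \<noteq> 0 \<Longrightarrow> f x = A x / B x"
    using assms(1) unfolding regular_at_def by blast
  obtain C D where 2: "polynomial_fun I C" "polynomial_fun I D" "D a \<noteq> 0" "\<And>x. D x \<noteq> 0 \<Longrightarrow> g x = C x / D x"
    using assms(2) unfolding regular_at_def by blast
  show ?thesis
    unfolding regular_at_def
  proof (rule exI[of _ "\<lambda>x. A x * C x"], rule exI[of _ "\<lambda>x. B x * D x"], intro conjI allI impI)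
    show "polynomial_fun I (\<lambda>x. A x * C x)" "polynomial_fun I (\<lambda>x. B x * D x)"
      by (intro polynomial_fun.add polynomial_fun.mult 1(1,2) 2(1,2))+
    show "f x * g x = A x * C x / (B x * D x)" if "B x * D x \<noteq> 0" for x
      using that 1(4)[of x] 2(4)[of x] by simp
  qed (use 1 2 in simp)
qed

lemma regular_at_diff:
  assumes "regular_at I a f" "regular_at I a g"
  shows "regular_at I a (\<lambda>x. f x - g x)"
proof -
  have "regular_at I a (\<lambda>x. f x + (- 1) * g x)"
    by (intro regular_at_add regular_at_mult regular_at_const assms)
  then show ?thesis by simp
qed

lemma regular_at_power:
  assumes "regular_at I a f"
  shows "regular_at I a (\<lambda>x. f x ^ k)"
  by (induction k) (simp_all add: regular_at_const regular_at_mult assms)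

lemma regular_at_divide:
  assumes "regular_at I a f" "regular_at I a g" "g a \<noteq> 0"
  shows "regular_at I a (\<lambda>x. f x / g x)"
proof -
  obtain C D where 2: "polynomial_fun I C" "polynomial_fun I D" "D a \<noteq> 0" "\<And>x. D x \<noteq> 0 \<Longrightarrow> g x = C x / D x"
    using assms(2) unfolding regular_at_def by blast
  have "C a \<noteq> 0" using 2(4)[of a] 2(3) assms(3) by auto
  have "regular_at I a (\<lambda>x. inverse (g x))"
    unfolding regular_at_def
  \<comment> \<open>The common factor \<open>D x\<close> restricts the claim to points where
    \<open>g x = C x / D x\<close> is known.\<close>
  proof (rule exI[of _ "\<lambda>x. D x * D x"], rule exI[of _ "\<lambda>x. C x * D x"], intro conjI allI impI)
    show "polynomial_fun I (\<lambda>x. D x * D x)" "polynomial_fun I (\<lambda>x. C x * D x)"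
      by (intro polynomial_fun.mult 2(1,2))+
    show "inverse (g x) = D x * D x / (C x * D x)" if "C x * D x \<noteq> 0" for x
      using that 2(4)[of x] by simp
  qed (use 2 \<open>C a \<noteq> 0\<close> in simp)
  then show ?thesis unfolding divide_inverse by (intro regular_at_mult assms)
qed

lemma nearby_nonzero:
  assumes "regular_at I a f" "f a \<noteq> 0"
  shows "nearby I a (\<lambda>x. f x \<noteq> 0)"
proof -
  obtain A B where 1: "polynomial_fun I A" "polynomial_fun I B" "B a \<noteq> 0" "\<And>x. B x \<noteq> 0 \<Longrightarrow> f x = A x / B x"
    using assms(1) unfolding regular_at_def by blast
  show ?thesis
    unfolding nearby_def
    using 1 1(4)[of a] assms(2) by (intro exI[of _ "\<lambda>x. A x * B x"]) (auto intro: polynomial_fun.mult)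
qed

lemma nearby_distinct:
  assumes "regular_at I a f" "regular_at I a g" "f a \<noteq> g a"
  shows "nearby I a (\<lambda>x. f x \<noteq> g x)"
  using nearby_nonzero[OF regular_at_diff[OF assms(1,2)]] assms(3) by simp

text \<open>Serves to evaluate \<open>P\<close> and \<open>Q\<close> along the section:
  \<open>J\<close> indexes the coordinates of the elements, \<open>I\<close> the invariants.\<close>

lemma regular_at_polynomial:
  assumes "polynomial_fun J p" "\<And>j. j \<in> J \<Longrightarrow> regular_at I a (\<lambda>x. g x j)"
  shows "regular_at I a (\<lambda>x. p (g x))"
  using assms
  by (induction rule: polynomial_fun.induct)
    (auto intro: regular_at_const regular_at_add regular_at_mult)

section \<open>Solving for directions and curvatures\<close>

lemma r_inv_cong: "v 1 = v' 1 \<Longrightarrow> v 2 = v' 2 \<Longrightarrow> v 3 = v' 3 \<Longrightarrow> v j = v' j \<Longrightarrow> r_inv v j = r_inv v' j"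
  by (simp add: r_inv_def xi_ratio_def)

lemma s_ratio_cong:
  assumes "v 1 = v' 1" "v 2 = v' 2" "v j = v' j" "w 1 = w' 1" "w 2 = w' 2" "w j = w' j"
  shows "s_ratio v w j = s_ratio v' w' j"
  using assms by (simp add: s_ratio_def xi_ratio_def eta_ratio_def)

lemma sigma_ratio_cong:
  assumes "\<And>k. k \<in> {1, 2, 3, j} \<Longrightarrow> v k = v' k" "\<And>k. k \<in> {1, 2, 3, j} \<Longrightarrow> w k = w' k"
  shows "sigma_ratio v w j = sigma_ratio v' w' j"
  using assms s_ratio_cong[of v v' j w w'] s_ratio_cong[of v v' 3 w w'] by (simp add: sigma_ratio_def)

lemma omega_term_cong:
  assumes "\<And>k. k \<in> {1, 2, 3, 4, j} \<Longrightarrow> v k = v' k" "\<And>k. k \<in> {1, 2, 3, 4, j} \<Longrightarrow> w k = w' k"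
  shows "omega_term v w j = omega_term v' w' j"
proof -
  have "sigma_ratio v w j = sigma_ratio v' w' j" "sigma_ratio v w 4 = sigma_ratio v' w' 4"
    by (intro sigma_ratio_cong; use assms in auto)+
  moreover have "r_inv v j = r_inv v' j" "r_inv v 4 = r_inv v' 4"
    by (intro r_inv_cong; use assms in auto)+
  ultimately show ?thesis by (simp add: omega_term_def tau_ratio_def)
qed

text \<open>The genericity conditions see no curvature beyond the fifth, so later ones may be varied
  freely.\<close>

lemma general_position_cong:
  assumes gp: "(v, w) \<in> general_position n" and n: "n \<ge> 4" and w: "\<And>k. k \<in> {1..5} \<Longrightarrow> w' k = w k"
    and ext: "w' \<in> extensional {1..n}"
  shows "(v, w') \<in> general_position n"
proof -
  have "s_ratio v w' 3 = s_ratio v w 3"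
    by (intro s_ratio_cong) (simp_all add: w)
  moreover have "sigma_ratio v w' 4 = sigma_ratio v w 4"
    by (intro sigma_ratio_cong) (auto simp: w)
  moreover have "omega_term v w' 5 = omega_term v w 5"
    by (intro omega_term_cong) (auto simp: w)
  ultimately show ?thesis
    using gp ext w[of 1] w[of 2] by (simp add: general_position_def element_systems_def PiE_iff)
qed

lemma r_quadratic_nonzero:
  assumes "(v, w) \<in> general_position n" "n \<ge> 4"
  shows "(r_inv v 4)\<^sup>2 - r_inv v 4 \<noteq> 0"
proof -
  note g = inj_on_eq_iff[OF general_positionD(1)[OF assms]]
  have "v 1 \<noteq> v 2" "v 2 \<noteq> v 3" "v 4 \<noteq> v 1" "v 1 \<noteq> v 3" "v 4 \<noteq> v 2" "v 4 \<noteq> v 3"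
    using assms(2) by (simp_all add: g)
  then show ?thesis by (simp add: r_inv_quadratic)
qed

text \<open>With the directions and the first four curvatures fixed, \<open>omega_term\<close> is
  affine in \<open>w l\<close> with non-zero slope: general position makes each layer of its
  definition invertible.\<close>

lemma omega_term_eq_iff:
  assumes gp: "(v, w) \<in> general_position n" and n: "n \<ge> 4" and l: "l \<in> {5..n}"
    and w: "\<And>k. k \<in> {1..4} \<Longrightarrow> w' k = w k"
  shows "omega_term v w' l = omega_term v w l \<longleftrightarrow> w' l = w l"
proof
  assume eq: "omega_term v w' l = omega_term v w l"
  note g = general_positionD[OF gp n]
  have s: "s_ratio v w' 3 = s_ratio v w 3"
    by (intro s_ratio_cong) (simp_all add: w)
  have s4: "sigma_ratio v w' 4 = sigma_ratio v w 4"
    by (intro sigma_ratio_cong) (auto simp: w)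
  have "tau_ratio v w' l = tau_ratio v w l"
    using eq r_quadratic_nonzero[OF gp n] by (simp add: omega_term_def)
  then have "sigma_ratio v w' l = sigma_ratio v w l"
    using g(4) by (simp add: tau_ratio_def s4)
  then have "s_ratio v w' l = s_ratio v w l"
    using g(3) by (simp add: sigma_ratio_def s)
  moreover have "v l \<noteq> v 1" "v 2 \<noteq> v 1" using l by (simp_all add: inj_on_eq_iff[OF g(1)])
  ultimately show "w' l = w l"
    using g(2) w[of 1] w[of 2] by (simp add: s_ratio_def eta_ratio_def xi_ratio_def)
next
  assume "w' l = w l"
  then show "omega_term v w' l = omega_term v w l"
    by (intro omega_term_cong) (auto simp: w)
qed

lemma Omega_inv_eq_iff:
  assumes gp: "(v, w) \<in> general_position n" and l: "l \<in> {6..n}"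
    and w: "\<And>k. k \<in> {1..5} \<Longrightarrow> w' k = w k"
  shows "Omega_inv v w' l = Omega_inv v w l \<longleftrightarrow> w' l = w l"
proof -
  have n: "n \<ge> 4" "n \<ge> 5" using l by auto
  have "omega_term v w' 5 = omega_term v w 5"
    by (intro omega_term_cong) (auto simp: w)
  moreover have "omega_term v w 5 \<noteq> 0" using general_positionD(5)[OF gp n] .
  moreover have "omega_term v w' l = omega_term v w l \<longleftrightarrow> w' l = w l"
    by (rule omega_term_eq_iff[OF gp n(1)]) (use l w in auto)
  ultimately show ?thesis by (simp add: Omega_inv_def)
qed

text \<open>For fixed base directions the cross-ratio is a Moebius function of the remaining one,
  hence injective. This makes the functions counted in \<open>r_family\<close> distinct.\<close>

lemma r_inv_eq_iff:
  assumes gp: "(v, w) \<in> general_position n" and n: "n \<ge> 4" and ij: "i \<in> {4..n}" "j \<in> {4..n}"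
  shows "r_inv v i = r_inv v j \<longleftrightarrow> i = j"
proof
  assume eq: "r_inv v i = r_inv v j"
  note g = inj_on_eq_iff[OF general_positionD(1)[OF gp n]]
  have d: "v 1 \<noteq> v 2" "v 2 \<noteq> v 3" "v i \<noteq> v 1" "v j \<noteq> v 1" "v 3 \<noteq> v 1"
    using n ij by (simp_all add: g)
  have "(v 3 - v 1) / (v 3 - v 2) * ((v i - v 2) / (v i - v 1)) =
      (v 3 - v 1) / (v 3 - v 2) * ((v j - v 2) / (v j - v 1))"
    using eq d by (simp add: r_inv_eq mult_ac)
  then have "(v i - v 2) / (v i - v 1) = (v j - v 2) / (v j - v 1)"
    using d by (subst (asm) mult_left_cancel) simp_all
  then have "(v i - v 2) * (v j - v 1) = (v j - v 2) * (v i - v 1)"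
    using d by (simp add: frac_eq_eq)
  then have "(v i - v j) * (v 2 - v 1) = 0"
    by (simp add: algebra_simps)
  then show "i = j" using d ij by (simp add: g)
qed simp

lemma general_position_nonempty:
  assumes "n \<ge> 4"
  obtains v w where "(v, w) \<in> general_position n"
proof -
  \<comment> \<open>With a single non-zero curvature, at index 2, every \<open>s_ratio v w k\<close>
    used is 0 and every \<sigma> is 1. The remaining conditions are numerical;
    \<open>omega_term v w 5\<close> comes out as \<open>- 1 / 12\<close>.\<close>
  define v where "v = (\<lambda>k\<in>{1..n}. of_nat k :: complex)"
  define w where "w = (\<lambda>k\<in>{1..n}. if k = 2 then 1 else 0 :: complex)"
  have v: "v k = of_nat k" and w: "w k = (if k = 2 then 1 else 0)" if "k \<in> {1..n}" for k
    using that by (simp_all add: v_def w_def)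
  have s: "s_ratio v w 3 = 0" "s_ratio v w 4 = 0"
    using assms by (simp_all add: s_ratio_def eta_ratio_def w)
  have r4: "r_inv v 4 = 4 / 3" using assms by (simp add: r_inv_def xi_ratio_def v)
  have "omega_term v w 5 \<noteq> 0" if "n \<ge> 5"
  proof -
    have s5: "s_ratio v w 5 = 0" using that by (simp add: s_ratio_def eta_ratio_def w)
    have r5: "r_inv v 5 = 3 / 2" using that by (simp add: r_inv_def xi_ratio_def v)
    show ?thesis
      unfolding omega_term_def tau_ratio_def sigma_ratio_def s s5 r4 r5 by (simp add: power2_eq_square)
  qed
  moreover have "inj_on v {1..n}" by (auto simp: inj_on_def v)
  moreover have "w 2 \<noteq> w 1" using assms by (simp add: w)
  moreover have "(v, w) \<in> element_systems n"
    by (simp add: element_systems_def v_def w_def)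
  ultimately have "(v, w) \<in> general_position n"
    by (simp add: general_position_def sigma_ratio_def s r4)
  then show ?thesis by (rule that)
qed

text \<open>
  The unknown \<open>v j\<close> in \<open>r_inv v j = \<rho>\<close>, and \<open>w l\<close> in \<open>Omega_inv v w l = \<omega>\<close>, each
  expressed by the preceding elements; \<open>curvature_of\<close> uses \<open>w\<close> only at \<open>1, \<dots>, 5\<close>.
\<close>

definition direction_of :: "(nat \<Rightarrow> complex) \<Rightarrow> complex \<Rightarrow> complex" where
  "direction_of v \<rho> = v 1 + (v 2 - v 1) * (xi_ratio v 3 / (xi_ratio v 3 - \<rho> * (xi_ratio v 3 - 1)))"

definition curvature_of :: "(nat \<Rightarrow> complex) \<Rightarrow> (nat \<Rightarrow> complex) \<Rightarrow> complex \<Rightarrow> nat \<Rightarrow> complex" where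
  "curvature_of v w \<omega> l = w 1 + (w 2 - w 1) * (xi_ratio v l ^ 3 * (1 + (s_ratio v w 3 - 1) *
     (r_inv v l + (sigma_ratio v w 4 - r_inv v 4) *
       ((\<omega> * omega_term v w 5 + ((r_inv v l)\<^sup>2 - r_inv v l)) / ((r_inv v 4)\<^sup>2 - r_inv v 4)))))"

lemma r_inv_direction_of:
  assumes "v 1 \<noteq> v 2" "v 1 \<noteq> v 3" "v 2 \<noteq> v 3" and d: "xi_ratio v 3 - \<rho> * (xi_ratio v 3 - 1) \<noteq> 0"
    and j: "v j = direction_of v \<rho>"
  shows "r_inv v j = \<rho>"
proof -
  define t where "t = xi_ratio v 3"
  define e where "e = t - \<rho> * (t - 1)"
  have t: "t \<noteq> 0" "t - 1 \<noteq> 0" "e \<noteq> 0"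
    using assms by (auto simp: t_def e_def xi_ratio_def)
  have "xi_ratio v j = t / e"
    using assms(1) unfolding xi_ratio_def[of v j] j direction_of_def by (simp add: t_def e_def)
  moreover from this have "xi_ratio v j - 1 = \<rho> * (t - 1) / e"
    using t(3) by (simp add: diff_divide_eq_iff divide_diff_eq_iff) (simp add: e_def)
  ultimately show ?thesis
    using t by (simp add: r_inv_def t_def[symmetric])
qed

text \<open>The denominator in \<open>direction_of\<close> becomes
  \<open>xi_ratio v 3 / xi_ratio v j\<close>. Its being non-zero makes the section regular at its
  base system.\<close>

lemma direction_of_r_inv:
  assumes "v 1 \<noteq> v 2" "v 1 \<noteq> v 3" "v 2 \<noteq> v 3" "v j \<noteq> v 1"
  shows "direction_of v (r_inv v j) = v j"
    and "xi_ratio v 3 - r_inv v j * (xi_ratio v 3 - 1) \<noteq> 0"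
proof -
  define t where "t = xi_ratio v 3"
  define x where "x = xi_ratio v j"
  have t: "t \<noteq> 0" "t - 1 \<noteq> 0" "x \<noteq> 0"
    using assms by (auto simp: t_def x_def xi_ratio_def)
  have "r_inv v j * (t - 1) = t * (x - 1) / x"
    using t by (simp add: r_inv_def t_def[symmetric] x_def[symmetric])
  then have d: "t - r_inv v j * (t - 1) = t / x"
    using t by (simp add: field_simps)
  then show "xi_ratio v 3 - r_inv v j * (xi_ratio v 3 - 1) \<noteq> 0"
    using t by (simp add: t_def)
  have "direction_of v (r_inv v j) = v 1 + (v 2 - v 1) * x"
    unfolding direction_of_def t_def[symmetric] d using t by simp
  then show "direction_of v (r_inv v j) = v j"
    using assms by (simp add: x_def xi_ratio_def)
qed

lemma curvature_of_cong:
  assumes "\<And>k. k \<in> {1..5} \<Longrightarrow> w k = w' k"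
  shows "curvature_of v w \<omega> l = curvature_of v w' \<omega> l"
proof -
  have "s_ratio v w 3 = s_ratio v w' 3"
    by (intro s_ratio_cong) (simp_all add: assms)
  moreover have "sigma_ratio v w 4 = sigma_ratio v w' 4"
    by (intro sigma_ratio_cong) (auto simp: assms)
  moreover have "omega_term v w 5 = omega_term v w' 5"
    by (intro omega_term_cong) (auto simp: assms)
  ultimately show ?thesis
    using assms[of 1] assms[of 2] by (simp add: curvature_of_def)
qed

lemma Omega_inv_curvature_of:
  assumes gp: "(v, w) \<in> general_position n" and l: "l \<in> {6..n}" and w: "w l = curvature_of v w \<omega> l"
  shows "Omega_inv v w l = \<omega>"
proof -
  have n: "n \<ge> 4" "n \<ge> 5" using l by auto
  note g = general_positionD[OF gp n(1)]
  have nz: "(r_inv v 4)\<^sup>2 - r_inv v 4 \<noteq> 0" by (rule r_quadratic_nonzero[OF gp n(1)])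
  have "v l \<noteq> v 1" "v 2 \<noteq> v 1" using l by (simp_all add: inj_on_eq_iff[OF g(1)])
  then have x: "xi_ratio v l \<noteq> 0" by (simp add: xi_ratio_def)
  \<comment> \<open>This is the value of \<open>tau_ratio\<close> obtained by solving
    \<open>Omega_inv v w l = \<omega>\<close> for it.\<close>
  define \<tau> where "\<tau> = (\<omega> * omega_term v w 5 + ((r_inv v l)\<^sup>2 - r_inv v l)) / ((r_inv v 4)\<^sup>2 - r_inv v 4)"
  have "w l - w 1 = (w 2 - w 1) * (xi_ratio v l ^ 3 * (1 + (s_ratio v w 3 - 1) *
      (r_inv v l + (sigma_ratio v w 4 - r_inv v 4) * \<tau>)))"
    unfolding w curvature_of_def \<tau>_def by simp
  then have "s_ratio v w l = 1 + (s_ratio v w 3 - 1) * (r_inv v l + (sigma_ratio v w 4 - r_inv v 4) * \<tau>)"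
    using g(2) x unfolding s_ratio_def[of v w l] eta_ratio_def by simp
  then have "sigma_ratio v w l = r_inv v l + (sigma_ratio v w 4 - r_inv v 4) * \<tau>"
    using g(3) unfolding sigma_ratio_def[of v w l] by simp
  then have "tau_ratio v w l = \<tau>"
    using g(4) unfolding tau_ratio_def by simp
  then have "omega_term v w l = \<omega> * omega_term v w 5"
    using nz by (simp add: omega_term_def[of v w l] \<tau>_def)
  then show ?thesis
    using g(5)[OF n(2)] by (simp add: Omega_inv_def)
qed

section \<open>Rational section and rational invariants\<close>

lemma rational_section:
  fixes n v0 w0
  defines "I \<equiv> ({4..n} <+> {6..n} :: (nat + nat) set)" and "a \<equiv> fundamental_coords (v0, w0)"
  assumes gp: "(v0, w0) \<in> general_position n" and n: "n \<ge> 4"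
  obtains V W where
    "\<And>k. k \<in> {1..n} \<Longrightarrow> regular_at I a (\<lambda>x. V x k)"
    "\<And>k. k \<in> {1..n} \<Longrightarrow> regular_at I a (\<lambda>x. W x k)"
    "V a = v0" "W a = w0"
    "nearby I a (\<lambda>x. (V x, W x) \<in> general_position n \<and> (\<forall>j\<in>{4..n}. r_inv (V x) j = x (Inl j)) \<and>
       (\<forall>l\<in>{6..n}. Omega_inv (V x) (W x) l = x (Inr l)))"
proof -
  note g = general_positionD[OF gp n]
  note v0_eq = inj_on_eq_iff[OF g(1)]
  have ext: "v0 \<in> extensional {1..n}" "w0 \<in> extensional {1..n}"
    using g(7) by (auto simp: element_systems_def PiE_def)
  have dist: "v0 1 \<noteq> v0 2" "v0 1 \<noteq> v0 3" "v0 2 \<noteq> v0 3" "v0 2 \<noteq> v0 1"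
    using n by (simp_all add: v0_eq)
  define V where "V x = (\<lambda>k\<in>{1..n}. if k \<le> 3 then v0 k else direction_of v0 (x (Inl k)))"
    for x :: "nat + nat \<Rightarrow> complex"
  \<comment> \<open>\<open>curvature_of\<close> is given \<open>w0\<close>, which agrees with
    \<open>W x\<close> up to index 5, so the definition is not circular.\<close>
  define W where "W x = (\<lambda>l\<in>{1..n}. if l \<le> 5 then w0 l else curvature_of (V x) w0 (x (Inr l)) l)" for x
  have a: "a (Inl j) = r_inv v0 j" "a (Inr j) = Omega_inv v0 w0 j" for j
    by (simp_all add: a_def fundamental_coords_def)
  have V3: "V x 1 = v0 1" "V x 2 = v0 2" "V x 3 = v0 3" for x
    using n by (simp_all add: V_def)
  have xi3: "xi_ratio (V x) 3 = xi_ratio v0 3" for x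
    by (simp only: xi_ratio_def V3)
  \<comment> \<open>Since the section passes through the base system at \<open>a\<close>, the
    denominators below are non-zero at \<open>a\<close> by general position of
    \<open>(v0, w0)\<close>.\<close>
  have Va: "V a = v0"
  proof (rule extensionalityI[OF _ ext(1)])
    fix k assume k: "k \<in> {1..n}"
    then have "v0 k \<noteq> v0 1" if "\<not> k \<le> 3" using that by (simp add: v0_eq)
    then show "V a k = v0 k"
      using k dist by (simp add: V_def a direction_of_r_inv(1))
  qed (simp add: V_def)
  have den: "xi_ratio v0 3 - a (Inl k) * (xi_ratio v0 3 - 1) \<noteq> 0" if "k \<in> {4..n}" for k
    unfolding a by (rule direction_of_r_inv(2)) (use that dist in \<open>simp_all add: v0_eq\<close>)
  have V: "regular_at I a (\<lambda>x. V x k)" if k: "k \<in> {1..n}" for k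
  proof (cases "k \<le> 3")
    case True
    then show ?thesis using k by (simp add: V_def regular_at_const)
  next
    case False
    then have k4: "k \<in> {4..n}" using k by simp
    then have "Inl k \<in> I" by (auto simp: I_def)
    then have "regular_at I a (\<lambda>x. direction_of v0 (x (Inl k)))"
      unfolding direction_of_def
      by (intro regular_at_add regular_at_mult regular_at_divide regular_at_diff regular_at_const
          regular_at_var den k4)
    then show ?thesis using k False by (simp add: V_def)
  qed
  have xi: "regular_at I a (\<lambda>x. xi_ratio (V x) k)" if "k \<in> {1..n}" for k
    unfolding xi_ratio_def V3
    using dist by (intro regular_at_divide regular_at_diff regular_at_const V that) simp
  have xi0: "xi_ratio v0 k \<noteq> 0" if "k \<in> {2..n}" for k
  proof -
    have "v0 k \<noteq> v0 1" using that by (simp add: v0_eq)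
    then show ?thesis using dist by (simp add: xi_ratio_def)
  qed
  have xi1: "xi_ratio v0 3 - 1 \<noteq> 0" using dist by (simp add: xi_ratio_def)
  have r: "regular_at I a (\<lambda>x. r_inv (V x) k)" if "k \<in> {2..n}" for k
    unfolding r_inv_def xi3
    using that xi0[OF that] xi1
    by (intro regular_at_divide regular_at_mult regular_at_diff regular_at_const xi) (auto simp: Va)
  have s: "regular_at I a (\<lambda>x. s_ratio (V x) w0 k)" if "k \<in> {2..n}" for k
    unfolding s_ratio_def
    using that xi0[OF that]
    by (intro regular_at_divide regular_at_power regular_at_const xi) (auto simp: Va)
  have s3: "s_ratio (V x) w0 3 = s_ratio v0 w0 3" for x
    by (simp add: s_ratio_def xi3)
  have sigma: "regular_at I a (\<lambda>x. sigma_ratio (V x) w0 k)" if "k \<in> {2..n}" for k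
    unfolding sigma_ratio_def s3
    using g(3) by (intro regular_at_divide regular_at_diff regular_at_const s that) simp
  have tau: "regular_at I a (\<lambda>x. tau_ratio (V x) w0 k)" if "k \<in> {2..n}" for k
    unfolding tau_ratio_def
    using g(4) n that by (intro regular_at_divide regular_at_diff r sigma) (auto simp: Va)
  have om: "regular_at I a (\<lambda>x. omega_term (V x) w0 k)" if "k \<in> {2..n}" for k
    unfolding omega_term_def
    using n that by (intro regular_at_diff regular_at_mult regular_at_power r tau) auto
  have W: "regular_at I a (\<lambda>x. W x k)" if k: "k \<in> {1..n}" for k
  proof (cases "k \<le> 5")
    case True
    then show ?thesis using k by (simp add: W_def regular_at_const)
  next
    case False
    then have k6: "Inr k \<in> I" "k \<in> {2..n}" "4 \<in> {2..n}" "5 \<in> {2..n}" using k by (auto simp: I_def)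
    have "(r_inv (V a) 4)\<^sup>2 - r_inv (V a) 4 \<noteq> 0"
      unfolding Va by (rule r_quadratic_nonzero[OF gp n])
    then have "regular_at I a (\<lambda>x. curvature_of (V x) w0 (x (Inr k)) k)"
      unfolding curvature_of_def s3 using k k6
      by (intro regular_at_add regular_at_mult regular_at_divide regular_at_diff regular_at_power
          regular_at_const regular_at_var xi r sigma om) auto
    then show ?thesis using k False by (simp add: W_def)
  qed
  \<comment> \<open>The conditions that vary with \<open>x\<close> are finitely many inequations
    between functions regular at \<open>a\<close>, all true at \<open>a\<close>. Working with
    \<open>w0\<close> suffices, because \<open>general_position_cong\<close> passes to
    \<open>W x\<close>.\<close>
  have near_gp: "nearby I a (\<lambda>x. (V x, w0) \<in> general_position n)"
  proof -
    have 1: "nearby I a (\<lambda>x. \<forall>i\<in>{1..n}. \<forall>j\<in>{1..n}. V x i = V x j \<longrightarrow> i = j)"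
    proof (intro nearby_Ball finite_atLeastAtMost)
      fix i j assume ij: "i \<in> {1..n}" "j \<in> {1..n}"
      show "nearby I a (\<lambda>x. V x i = V x j \<longrightarrow> i = j)"
      proof (cases "i = j")
        case False
        then have "nearby I a (\<lambda>x. V x i \<noteq> V x j)"
          using ij by (intro nearby_distinct V) (simp_all add: Va v0_eq)
        then show ?thesis by (rule nearby_mono) simp
      qed (simp add: nearby_const)
    qed
    have 2: "nearby I a (\<lambda>x. sigma_ratio (V x) w0 4 \<noteq> r_inv (V x) 4)"
      using n g(4) by (intro nearby_distinct r sigma) (auto simp: Va)
    have 3: "nearby I a (\<lambda>x. n \<ge> 5 \<longrightarrow> omega_term (V x) w0 5 \<noteq> 0)"
    proof (cases "n \<ge> 5")
      case True
      then have "nearby I a (\<lambda>x. omega_term (V x) w0 5 \<noteq> 0)"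
        using g(5) by (intro nearby_nonzero om) (auto simp: Va)
      then show ?thesis by (rule nearby_mono) simp
    qed (simp add: nearby_const)
    show ?thesis
    proof (rule nearby_mono[OF nearby_conj[OF 1 nearby_conj[OF 2 3]]])
      fix x assume *: "(\<forall>i\<in>{1..n}. \<forall>j\<in>{1..n}. V x i = V x j \<longrightarrow> i = j) \<and>
        sigma_ratio (V x) w0 4 \<noteq> r_inv (V x) 4 \<and> (5 \<le> n \<longrightarrow> omega_term (V x) w0 5 \<noteq> 0)"
      then have "inj_on (V x) {1..n}" unfolding inj_on_def by blast
      moreover have "(V x, w0) \<in> element_systems n"
        using g(7) by (simp add: element_systems_def V_def)
      ultimately show "(V x, w0) \<in> general_position n"
        using * g(2,3) by (simp add: general_position_def s3)
    qed
  qed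
  have near_r: "nearby I a (\<lambda>x. \<forall>j\<in>{4..n}. r_inv (V x) j = x (Inl j))"
  proof (intro nearby_Ball finite_atLeastAtMost)
    fix j assume j: "j \<in> {4..n}"
    then have "Inl j \<in> I" by (auto simp: I_def)
    then have "nearby I a (\<lambda>x. xi_ratio v0 3 - x (Inl j) * (xi_ratio v0 3 - 1) \<noteq> 0)"
      by (intro nearby_nonzero den regular_at_diff regular_at_mult regular_at_const regular_at_var j)
    then show "nearby I a (\<lambda>x. r_inv (V x) j = x (Inl j))"
    proof (rule nearby_mono)
      fix x :: "nat + nat \<Rightarrow> complex"
      assume "xi_ratio v0 3 - x (Inl j) * (xi_ratio v0 3 - 1) \<noteq> 0"
      moreover have "V x j = direction_of (V x) (x (Inl j))"
        using j V3[of x] xi3[of x] by (simp add: V_def[of x] direction_of_def)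
      ultimately show "r_inv (V x) j = x (Inl j)"
        using dist by (intro r_inv_direction_of) (simp_all only: V3 xi3 not_False_eq_True)
    qed
  qed
  have W5: "W x k = w0 k" if "k \<in> {1..5}" for x k
  proof (cases "k \<in> {1..n}")
    \<comment> \<open>For \<open>n = 4\<close> the index 5 is out of range, and extensional families
      agree there by being \<open>undefined\<close>.\<close>
    case False
    then have "W x k = undefined" "w0 k = undefined"
      using extensional_arb[OF ext(2)] unfolding W_def by (simp_all only: restrict_apply if_False)
    then show ?thesis by simp
  qed (use that in \<open>simp add: W_def\<close>)
  have W_gp: "(V x, W x) \<in> general_position n" if "(V x, w0) \<in> general_position n" for x
    by (rule general_position_cong[OF that n W5]) (auto simp: W_def extensional_def)
  have W_Omega: "Omega_inv (V x) (W x) l = x (Inr l)"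
    if "(V x, w0) \<in> general_position n" "l \<in> {6..n}" for x l
  proof (rule Omega_inv_curvature_of[OF W_gp[OF that(1)] that(2)])
    have "W x l = curvature_of (V x) w0 (x (Inr l)) l"
      using that(2) by (simp add: W_def)
    also have "\<dots> = curvature_of (V x) (W x) (x (Inr l)) l"
      by (rule curvature_of_cong) (simp add: W5)
    finally show "W x l = \<dots>" .
  qed
  have Wa: "W a = w0"
  proof (rule extensionalityI[OF _ ext(2)])
    fix k assume k: "k \<in> {1..n}"
    show "W a k = w0 k"
    proof (cases "k \<le> 5")
      case False
      then have k6: "k \<in> {6..n}" using k by simp
      \<comment> \<open>At \<open>a\<close> the section has the \<Omega> of the base system, and
        these determine the curvatures from the sixth on.\<close>
      have "Omega_inv v0 (W a) k = Omega_inv v0 w0 k"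
        using W_Omega[of a k] gp k6 unfolding Va a by blast
      moreover have "Omega_inv v0 (W a) k = Omega_inv v0 w0 k \<longleftrightarrow> W a k = w0 k"
        by (rule Omega_inv_eq_iff[OF gp k6 W5])
      ultimately show ?thesis by blast
    qed (use k W5 in simp)
  qed (simp add: W_def)
  have "nearby I a (\<lambda>x. (V x, W x) \<in> general_position n \<and> (\<forall>j\<in>{4..n}. r_inv (V x) j = x (Inl j)) \<and>
       (\<forall>l\<in>{6..n}. Omega_inv (V x) (W x) l = x (Inr l)))"
    by (rule nearby_mono[OF nearby_conj[OF near_gp near_r]]) (use W_gp W_Omega in blast)
  with V W Va Wa show ?thesis by (rule that)
qed

lemma rational_completeness:
  assumes n: "n \<ge> 4" and P: "polynomial_fun ({1..n} <+> {1..n}) P" and Q: "polynomial_fun ({1..n} <+> {1..n}) Q"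
    and inv: "absolute_invariant n {e \<in> general_position n. Q (element_coords e) \<noteq> 0}
          (\<lambda>e. P (element_coords e) / Q (element_coords e))"
  shows "\<exists>A B. polynomial_fun ({4..n} <+> {6..n}) A \<and> polynomial_fun ({4..n} <+> {6..n}) B \<and>
           (\<exists>e\<in>general_position n. B (fundamental_coords e) \<noteq> 0) \<and>
           (\<forall>e\<in>general_position n.
              Q (element_coords e) \<noteq> 0 \<and> B (fundamental_coords e) \<noteq> 0 \<longrightarrow>
              P (element_coords e) / Q (element_coords e) =
              A (fundamental_coords e) / B (fundamental_coords e))"
proof (cases "\<exists>e\<in>general_position n. Q (element_coords e) \<noteq> 0")
  \<comment> \<open>If \<open>Q\<close> vanishes throughout general position the identity is
    vacuous, and constants serve as \<open>A\<close> and \<open>B\<close>.\<close>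
  case False
  obtain v w where "(v, w) \<in> general_position n"
    using general_position_nonempty[OF n] .
  with False show ?thesis
    by (intro exI[of _ "\<lambda>x. 1"]) (auto intro: polynomial_fun.const)
next
  case True
  then obtain v0 w0 where gp: "(v0, w0) \<in> general_position n" and Q0: "Q (element_coords (v0, w0)) \<noteq> 0"
    by auto
  define I :: "(nat + nat) set" where "I = {4..n} <+> {6..n}"
  define a where "a = fundamental_coords (v0, w0)"
  obtain V W where V: "\<And>k. k \<in> {1..n} \<Longrightarrow> regular_at I a (\<lambda>x. V x k)"
    and W: "\<And>k. k \<in> {1..n} \<Longrightarrow> regular_at I a (\<lambda>x. W x k)"
    and a: "V a = v0" "W a = w0"
    and near: "nearby I a (\<lambda>x. (V x, W x) \<in> general_position n \<and> (\<forall>j\<in>{4..n}. r_inv (V x) j = x (Inl j)) \<and>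
       (\<forall>l\<in>{6..n}. Omega_inv (V x) (W x) l = x (Inr l)))"
    using rational_section[OF gp n] unfolding I_def a_def by blast
  have coords: "regular_at I a (\<lambda>x. element_coords (V x, W x) i)" if "i \<in> {1..n} <+> {1..n}" for i
    using that V W by (auto simp: element_coords_def)
  have RP: "regular_at I a (\<lambda>x. P (element_coords (V x, W x)))"
    by (rule regular_at_polynomial[OF P coords])
  have RQ: "regular_at I a (\<lambda>x. Q (element_coords (V x, W x)))"
    by (rule regular_at_polynomial[OF Q coords])
  have Qa: "Q (element_coords (V a, W a)) \<noteq> 0" using Q0 by (simp add: a)
  have RPQ: "regular_at I a (\<lambda>x. P (element_coords (V x, W x)) / Q (element_coords (V x, W x)))"
    by (rule regular_at_divide[where g = "\<lambda>x. Q (element_coords (V x, W x))", OF RP RQ Qa])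
  have nearby_Q: "nearby I a (\<lambda>x. Q (element_coords (V x, W x)) \<noteq> 0)"
    by (rule nearby_nonzero[where f = "\<lambda>x. Q (element_coords (V x, W x))", OF RQ Qa])
  obtain A B where AB: "polynomial_fun I A" "polynomial_fun I B" "B a \<noteq> 0"
    "\<And>x. B x \<noteq> 0 \<Longrightarrow> P (element_coords (V x, W x)) / Q (element_coords (V x, W x)) = A x / B x"
    using RPQ unfolding regular_at_def by blast
  define G where "G x \<longleftrightarrow> Q (element_coords (V x, W x)) \<noteq> 0 \<and> (V x, W x) \<in> general_position n \<and>
      (\<forall>j\<in>{4..n}. r_inv (V x) j = x (Inl j)) \<and> (\<forall>l\<in>{6..n}. Omega_inv (V x) (W x) l = x (Inr l))" for x
  have "nearby I a G"
    using nearby_conj[OF nearby_Q near] by (simp add: G_def[abs_def])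
  then obtain C where C: "polynomial_fun I C" "C a \<noteq> 0" and C': "\<And>x. C x \<noteq> 0 \<Longrightarrow> G x"
    unfolding nearby_def by blast
  show ?thesis unfolding I_def[symmetric]
  \<comment> \<open>The factor \<open>C\<close> confines the identity to arguments \<open>x\<close>
    at which the section is in general position, realises the invariants \<open>x\<close> and avoids
    the zeros of \<open>Q\<close>.\<close>
  proof (rule exI[of _ "\<lambda>x. A x * C x"], rule exI[of _ "\<lambda>x. B x * C x"], intro conjI ballI impI)
    show "polynomial_fun I (\<lambda>x. A x * C x)" "polynomial_fun I (\<lambda>x. B x * C x)"
      by (intro polynomial_fun.mult AB C)+
    show "\<exists>e\<in>general_position n. B (fundamental_coords e) * C (fundamental_coords e) \<noteq> 0"
      using gp AB(3) C(2) by (intro bexI[of _ "(v0, w0)"]) (simp_all add: a_def)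
    fix e assume e: "e \<in> general_position n"
      and ne: "Q (element_coords e) \<noteq> 0 \<and> B (fundamental_coords e) * C (fundamental_coords e) \<noteq> 0"
    obtain v w where vw: "e = (v, w)" by (metis surj_pair)
    define x where "x = fundamental_coords e"
    have x: "x (Inl j) = r_inv v j" "x (Inr j) = Omega_inv v w j" for j
      by (simp_all add: x_def vw fundamental_coords_def)
    have nz: "B x \<noteq> 0" "C x \<noteq> 0" using ne by (simp_all add: x_def)
    \<comment> \<open>The system \<open>e\<close> and the section point over its invariants lie in
      one orbit, so \<open>P / Q\<close> agrees on them.\<close>
    have "P (element_coords e) / Q (element_coords e) = P (element_coords (V x, W x)) / Q (element_coords (V x, W x))"
      unfolding vw
    proof (rule absolute_invariant_eq[OF n inv])
      show "(v, w) \<in> {e \<in> general_position n. Q (element_coords e) \<noteq> 0}"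
        "(V x, W x) \<in> {e \<in> general_position n. Q (element_coords e) \<noteq> 0}"
        using e ne C'[OF nz(2)] by (auto simp: vw G_def)
      show "r_inv v j = r_inv (V x) j" if "j \<in> {4..n}" for j
        using C'[OF nz(2)] that by (simp add: x G_def)
      show "Omega_inv v w l = Omega_inv (V x) (W x) l" if "l \<in> {6..n}" for l
        using C'[OF nz(2)] that by (simp add: x G_def)
    qed auto
    also have "\<dots> = A x / B x" by (rule AB(4)[OF nz(1)])
    also have "\<dots> = A x * C x / (B x * C x)" using nz by simp
    finally show "P (element_coords e) / Q (element_coords e) =
        A (fundamental_coords e) * C (fundamental_coords e) / (B (fundamental_coords e) * C (fundamental_coords e))"
      by (simp add: x_def)
  qed
qed

text \<open>Altering \<open>w l\<close> alone keeps general position and moves only the \<Omega>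
  with index \<open>l\<close>. Hence each \<Omega> depends on curvature, they are pairwise distinct,
  and none is a cross-ratio.\<close>

lemma Omega_inv_separates:
  assumes l: "l \<in> {6..n}"
  obtains v w w' where "(v, w) \<in> general_position n" "(v, w') \<in> general_position n"
    "Omega_inv v w' l \<noteq> Omega_inv v w l"
    "\<And>k. k \<in> {6..n} \<Longrightarrow> k \<noteq> l \<Longrightarrow> Omega_inv v w' k = Omega_inv v w k"
proof -
  have n: "n \<ge> 4" using l by simp
  obtain v w where gp: "(v, w) \<in> general_position n"
    using general_position_nonempty[OF n] .
  define w' where "w' = w(l := w l + 1)"
  have w': "w' k = w k" if "k \<in> {1..5}" for k using that l by (auto simp: w'_def)
  have "w \<in> extensional {1..n}"
    using general_positionD(7)[OF gp n] by (auto simp: element_systems_def PiE_def)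
  then have "w' \<in> extensional {1..n}" using l by (auto simp: w'_def extensional_def)
  then have "(v, w') \<in> general_position n"
    by (intro general_position_cong[OF gp n w'])
  moreover have "Omega_inv v w' k = Omega_inv v w k \<longleftrightarrow> w' k = w k" if "k \<in> {6..n}" for k
    by (rule Omega_inv_eq_iff[OF gp that w'])
  then have "Omega_inv v w' k = Omega_inv v w k \<longleftrightarrow> k \<noteq> l" if "k \<in> {6..n}" for k
    using that by (simp add: w'_def)
  ultimately show ?thesis
    using gp l by (intro that[of v w w']) simp_all
qed

section \<open>Number of independent invariants\<close>

lemma involves_curvature_Omega:
  assumes "l \<in> {6..n}"
  shows "involves_curvature n (\<lambda>(v, w). Omega_inv v w l)"
  using Omega_inv_separates[OF assms] unfolding involves_curvature_def by (metis (no_types, lifting) case_prod_conv)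

lemma card_r_family:
  assumes "n \<ge> 4"
  shows "card (r_family n) = n - 3"
proof -
  obtain v w where gp: "(v, w) \<in> general_position n"
    using general_position_nonempty[OF assms] .
  have "inj_on (\<lambda>j. \<lambda>(v, w)\<in>general_position n. r_inv v j) {4..n}"
  proof (rule inj_onI)
    fix i j assume "i \<in> {4..n}" "j \<in> {4..n}"
      and "(\<lambda>(v, w)\<in>general_position n. r_inv v i) = (\<lambda>(v, w)\<in>general_position n. r_inv v j)"
    then show "i = j"
      using gp r_inv_eq_iff[OF gp assms] by (auto dest: fun_cong[of _ _ "(v, w)"])
  qed
  then show ?thesis using assms by (simp add: r_family_def card_image)
qed

text \<open>For \<open>n \<le> 5\<close> the index set is empty, in accordance with truncated
  subtraction.\<close>

lemma card_Omega_family: "card (Omega_family n) = n - 5"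
proof -
  have "inj_on (\<lambda>l. \<lambda>(v, w)\<in>general_position n. Omega_inv v w l) {6..n}"
  proof (rule inj_onI, rule ccontr)
    fix k l assume kl: "k \<in> {6..n}" "l \<in> {6..n}" "k \<noteq> l"
      and eq: "(\<lambda>(v, w)\<in>general_position n. Omega_inv v w k) = (\<lambda>(v, w)\<in>general_position n. Omega_inv v w l)"
    obtain v w w' where *: "(v, w) \<in> general_position n" "(v, w') \<in> general_position n"
      "Omega_inv v w' l \<noteq> Omega_inv v w l" "Omega_inv v w' k = Omega_inv v w k"
      using Omega_inv_separates[OF kl(2)] kl(1,3) by metis
    then show False
      using fun_cong[OF eq, of "(v, w)"] fun_cong[OF eq, of "(v, w')"] by simp
  qed
  then show ?thesis by (simp add: Omega_family_def card_image)
qed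

lemma r_family_Omega_family_disjoint: "r_family n \<inter> Omega_family n = {}"
proof (rule ccontr)
  assume "r_family n \<inter> Omega_family n \<noteq> {}"
  then obtain j l where l: "l \<in> {6..n}"
    and eq: "(\<lambda>(v, w)\<in>general_position n. r_inv v j) = (\<lambda>(v, w)\<in>general_position n. Omega_inv v w l)"
    unfolding r_family_def Omega_family_def by blast
  obtain v w w' where *: "(v, w) \<in> general_position n" "(v, w') \<in> general_position n"
    "Omega_inv v w' l \<noteq> Omega_inv v w l"
    using Omega_inv_separates[OF l] by metis
  then show False
    using fun_cong[OF eq, of "(v, w)"] fun_cong[OF eq, of "(v, w')"] by simp
qed

text \<open>Up to five elements there is no \<Omega>, so generic systems with the same directions
  share all fundamental invariants and \<open>F\<close> cannot tell them apart.\<close>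

lemma involves_curvature_imp_ge_6:
  assumes n: "n \<ge> 4" and inv: "absolute_invariant n (general_position n) F" and "involves_curvature n F"
  shows "n \<ge> 6"
proof (rule ccontr)
  assume "\<not> n \<ge> 6"
  obtain v w w' where "(v, w) \<in> general_position n" "(v, w') \<in> general_position n" "F (v, w) \<noteq> F (v, w')"
    using assms(3) unfolding involves_curvature_def by blast
  moreover from this(1,2) have "F (v, w) = F (v, w')"
    by (rule absolute_invariant_eq[OF n inv subset_refl]) (use \<open>\<not> n \<ge> 6\<close> in auto)
  ultimately show False by simp
qed

theorem theorem4p1:
  fixes n :: nat
  assumes "n \<ge> 4"
  shows
    "(\<forall>j\<in>{4..n}. absolute_invariant n (general_position n) (\<lambda>(v, w). r_inv v j) \<and>
        \<not> involves_curvature n (\<lambda>(v, w). r_inv v j)) \<and>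
     (\<forall>l\<in>{6..n}. absolute_invariant n (general_position n) (\<lambda>(v, w). Omega_inv v w l) \<and>
        involves_curvature n (\<lambda>(v, w). Omega_inv v w l)) \<and>
     card (r_family n) = n - 3 \<and>
     (n \<ge> 6 \<longrightarrow> card (Omega_family n) = n - 5) \<and>
     (n \<ge> 5 \<longrightarrow> card (r_family n \<union> Omega_family n) = 2 * n - 8) \<and>
     ((\<exists>F. absolute_invariant n (general_position n) F \<and> involves_curvature n F) \<longleftrightarrow> n \<ge> 6) \<and>
     (\<forall>D F. D \<subseteq> general_position n \<and> absolute_invariant n D F \<longrightarrow>
        (\<exists>\<Phi> :: (nat \<Rightarrow> complex) \<Rightarrow> (nat \<Rightarrow> complex) \<Rightarrow> complex. \<forall>(v, w)\<in>D.
           F (v, w) = \<Phi> (\<lambda>j\<in>{4..n}. r_inv v j) (\<lambda>l\<in>{6..n}. Omega_inv v w l))) \<and>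
     (\<forall>P Q. polynomial_fun ({1..n} <+> {1..n}) P \<and> polynomial_fun ({1..n} <+> {1..n}) Q \<and>
        (\<exists>x. Q x \<noteq> 0) \<and>
        absolute_invariant n {e \<in> general_position n. Q (element_coords e) \<noteq> 0}
          (\<lambda>e. P (element_coords e) / Q (element_coords e)) \<longrightarrow>
        (\<exists>A B. polynomial_fun ({4..n} <+> {6..n}) A \<and> polynomial_fun ({4..n} <+> {6..n}) B \<and>
           (\<exists>e\<in>general_position n. B (fundamental_coords e) \<noteq> 0) \<and>
           (\<forall>e\<in>general_position n.
              Q (element_coords e) \<noteq> 0 \<and> B (fundamental_coords e) \<noteq> 0 \<longrightarrow>
              P (element_coords e) / Q (element_coords e) =
              A (fundamental_coords e) / B (fundamental_coords e))))"
proof (intro conjI ballI allI impI)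
  show "absolute_invariant n (general_position n) (\<lambda>(v, w). r_inv v j)" if "j \<in> {4..n}" for j
    by (rule absolute_invariant_r[OF assms that])
  show "\<not> involves_curvature n (\<lambda>(v, w). r_inv v j)" for j
    by (simp add: involves_curvature_def)
  show "absolute_invariant n (general_position n) (\<lambda>(v, w). Omega_inv v w l)" if "l \<in> {6..n}" for l
    by (rule absolute_invariant_Omega[OF that])
  show "involves_curvature n (\<lambda>(v, w). Omega_inv v w l)" if "l \<in> {6..n}" for l
    by (rule involves_curvature_Omega[OF that])
  show "card (r_family n) = n - 3"
    by (rule card_r_family[OF assms])
  show "card (Omega_family n) = n - 5"
    by (rule card_Omega_family)
  show "card (r_family n \<union> Omega_family n) = 2 * n - 8" if "n \<ge> 5"
  proof -
    have "finite (r_family n)" "finite (Omega_family n)"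
      by (simp_all add: r_family_def Omega_family_def)
    \<comment> \<open>This sum is \<open>2 * n - 8\<close> from \<open>n = 5\<close> on; at
      \<open>n = 4\<close> truncated subtraction makes it 1 rather than 0.\<close>
    then have "card (r_family n \<union> Omega_family n) = (n - 3) + (n - 5)"
      by (simp add: card_Un_disjoint r_family_Omega_family_disjoint card_r_family[OF assms] card_Omega_family)
    then show ?thesis using that by simp
  qed
  show "(\<exists>F. absolute_invariant n (general_position n) F \<and> involves_curvature n F) \<longleftrightarrow> n \<ge> 6"
  proof
    assume "n \<ge> 6"
    then have "6 \<in> {6..n}" by simp
    then show "\<exists>F. absolute_invariant n (general_position n) F \<and> involves_curvature n F"
      using absolute_invariant_Omega involves_curvature_Omega by blast
  qed (use involves_curvature_imp_ge_6[OF assms] in blast)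
  show "\<exists>\<Phi>. \<forall>(v, w)\<in>D. F (v, w) = \<Phi> (\<lambda>j\<in>{4..n}. r_inv v j) (\<lambda>l\<in>{6..n}. Omega_inv v w l)"
    if "D \<subseteq> general_position n \<and> absolute_invariant n D F" for D F
    using functional_completeness[OF assms] that by blast
qed (elim conjE, rule rational_completeness[OF assms]; assumption)

end
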